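(* Let $\theta_1,\theta_2,\alpha,\beta$ be fixed real numbers with $\alpha\neq0,1$, and let $0<\delta<1$. Let $\mathcal{N}(M,\alpha,\delta)$ be the number of $(m_1,m_2,m_3,m_4)\in\mathbb{Z}^4\cap[M,2M]^4$ satisfying $$\left|(m_1+\theta_1)^\alpha-(m_2+\theta_1)^\alpha+\beta(m_3+\theta_2)^\alpha-\beta(m_4+\theta_2)^\alpha\right|\le\delta M^\alpha.$$ Then for every $\varepsilon>0$, $$\mathcal{N}(M,\alpha,\delta)\ll_{\alpha,\beta,\varepsilon,\theta_1,\theta_2}M^{2+\varepsilon}+\delta M^{4+\varepsilon}.$$
   Context: $M$ is a (large) positive integer, so that the bases $m_i+\theta_j$ are positive and the real powers are defined.
   Formalization: The formal theorem also assumes β ≠ 0; for β = 0 the bound is false, since the tuples (m,m,m_3,m_4) alone give (M+1)^3 solutions, which exceeds the claimed bound for δ = M^{-2} and ε < 1. *)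

theory Defs
  imports Complex_Main
begin

text \<open>
  The real power \<^term>\<open>x powr \<alpha>\<close> is the usual one only for \<^term>\<open>x > 0\<close>; the count is used
  only when \<open>M\<close>, \<open>M + \<theta>1\<close> and \<open>M + \<theta>2\<close> are positive, so that every base below is positive.
\<close>

definition approx_solutions ::
    "real \<Rightarrow> real \<Rightarrow> real \<Rightarrow> nat \<Rightarrow> real \<Rightarrow> real \<Rightarrow> (int \<times> int \<times> int \<times> int) set" where
  "approx_solutions \<theta>1 \<theta>2 \<beta> M \<alpha> \<delta> =
     {(m1, m2, m3, m4).
        {m1, m2, m3, m4} \<subseteq> {int M..2 * int M} \<and>
        \<bar>(of_int m1 + \<theta>1) powr \<alpha> - (of_int m2 + \<theta>1) powr \<alpha>
           + \<beta> * (of_int m3 + \<theta>2) powr \<alpha> - \<beta> * (of_int m4 + \<theta>2) powr \<alpha>\<bar>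
          \<le> \<delta> * real M powr \<alpha>}"

definition approx_count :: "real \<Rightarrow> real \<Rightarrow> real \<Rightarrow> nat \<Rightarrow> real \<Rightarrow> real \<Rightarrow> nat" where
  "approx_count \<theta>1 \<theta>2 \<beta> M \<alpha> \<delta> = card (approx_solutions \<theta>1 \<theta>2 \<beta> M \<alpha> \<delta>)"

end

theory Submission
  imports Defs
begin

text \<open>Assume \<open>\<beta> > 0\<close> (otherwise exchange \<open>m3\<close> and \<open>m4\<close>) and let
  \<open>g(x, y) = (x powr \<alpha> + \<beta> * y powr \<alpha>) powr (1 / \<alpha>) = x * \<mu> (y / x)\<close>. Up to constants the solutions are the
  pairs of points \<open>p\<close>, \<open>p'\<close> of a translate of the integer lattice at height about \<open>M\<close> with
  \<open>\<bar>g p - g p'\<bar> \<le> \<delta> * M\<close>, and a binning argument reduces everything to the tolerance \<open>\<eta> / M\<close>.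
  Only two features of \<open>g\<close> matter: it is homogeneous of degree one, and \<open>\<mu>''\<close> has no zero.

  Put two solutions \<open>(p, p')\<close>, \<open>(u, u')\<close> into the same cell if the slopes of \<open>p\<close>, \<open>u\<close> and those of
  \<open>p'\<close>, \<open>u'\<close> agree up to \<open>c / M\<close>; there are \<open>O(M^2)\<close> cells. By homogeneity the difference
  \<open>(p - u, p' - u')\<close>, which is an integer vector, is again a solution, at the scale \<open>q\<close> of
  \<open>p - u\<close> and with tolerance \<open>\<eta> / q\<close>, so a cell with many solutions contains one with small \<open>q\<close>.
  Conversely, the cells that give rise to a fixed difference \<open>(P, P')\<close> are those whose slopes \<open>(s, t)\<close>
  satisfy \<open>T(s) = T'(t) + O(1 / M)\<close>, where \<open>T\<close> and \<open>T'\<close> evaluate the tangents of \<open>g\<close> at \<open>P\<close> and \<open>P'\<close>.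
  As \<open>T\<close> and \<open>T'\<close> have nondegenerate extrema, at the slopes of \<open>P\<close> and \<open>P'\<close>, there are only
  \<open>O((M / q) * ln (M / q))\<close> of these. Hence the number \<open>n(M)\<close> of solutions at scale \<open>M\<close> satisfies
  \<open>n(M) \<le> C * K * M^2 + C * (\<Sum>q. (M / q)^2 * ln (M / q) * n(q))\<close>, where \<open>q\<close> runs over the dyadic
  scales up to \<open>M / K\<close>. For \<open>K\<close> large depending on \<open>\<epsilon>\<close> this recursion gives \<open>n(M) = O(M powr (2 + \<epsilon>))\<close>.\<close>

section \<open>Sparse sets of integer points\<close>

lemma sum_inverse_le_ln:
  "(\<Sum>k=1..n. 1 / real k) \<le> 1 + ln (real n)" if "n \<ge> 1"
  using that
proof (induction n rule: dec_induct)
  case base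
  then show ?case by simp
next
  case (step n)
  have n: "real n > 0" using step by simp
  have "ln (real n / real (Suc n)) \<le> real n / real (Suc n) - 1"
    using n by (intro ln_le_minus_one) auto
  also have "\<dots> = - 1 / real (Suc n)" by (simp add: field_simps)
  finally have "1 / real (Suc n) \<le> ln (real (Suc n)) - ln (real n)"
    using n by (simp add: ln_div)
  with step.IH show ?case by simp
qed

lemma card_int_set_spread_le:
  fixes A :: "int set" and d :: real
  assumes "finite A" "d \<ge> 0" and spread: "\<And>x y. x \<in> A \<Longrightarrow> y \<in> A \<Longrightarrow> x < y \<Longrightarrow> of_int (y - x) \<le> d"
  shows "real (card A) \<le> 1 + d"
proof (cases "A = {}")
  case False
  define a where "a = Min A"
  have a: "a \<in> A" "\<And>x. x \<in> A \<Longrightarrow> a \<le> x" using False assms(1) by (auto simp: a_def)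
  have "A \<subseteq> {a..a + \<lfloor>d\<rfloor>}"
  proof
    fix x assume x: "x \<in> A"
    have "x - a \<le> \<lfloor>d\<rfloor>"
      using spread[OF a(1) x] a(2)[OF x] assms(2) by (cases "a = x") (auto simp: le_floor_iff)
    then show "x \<in> {a..a + \<lfloor>d\<rfloor>}" using a(2)[OF x] by auto
  qed
  then have "card A \<le> card {a..a + \<lfloor>d\<rfloor>}" by (intro card_mono) auto
  also have "\<dots> = nat (1 + \<lfloor>d\<rfloor>)" by simp
  finally have "real (card A) \<le> real (nat (1 + \<lfloor>d\<rfloor>))" by simp
  also have "\<dots> \<le> 1 + d" using assms(2) by (simp add: of_nat_nat)
  finally show ?thesis .
qed (use assms in auto)

text \<open>In a row \<open>i\<close> \<noteq> 0, the entries \<open>j\<close> of one sign with |j|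
  \<ge> |i| lie in an interval of length \<open>D * n / |i|\<close>, by \<open>gap\<close>. Summing
  over \<open>i\<close> gives a harmonic sum, which is the source of the logarithm. The row
  \<open>i\<close> = 0, where \<open>gap\<close> is silent, has at most 2 n + 1 points.\<close>

lemma card_lower_part_le:
  fixes G :: "(int \<times> int) set" and D :: real and n :: nat
  assumes n: "n \<ge> 1" and D: "D \<ge> 0"
    and box: "G \<subseteq> {-int n..int n} \<times> {-int n..int n}"
    and gap: "\<And>i j j'. (i, j) \<in> G \<Longrightarrow> (i, j') \<in> G \<Longrightarrow> i \<noteq> 0 \<Longrightarrow> 0 < j * j' \<Longrightarrow> \<bar>i\<bar> \<le> \<bar>j\<bar> \<Longrightarrow> \<bar>j\<bar> < \<bar>j'\<bar>
                \<Longrightarrow> of_int ((\<bar>j'\<bar> - \<bar>j\<bar>) * \<bar>i\<bar>) \<le> D * real n"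
  shows "real (card {z \<in> G. \<bar>fst z\<bar> \<le> \<bar>snd z\<bar>}) \<le> (7 + 4 * D) * real n * (1 + ln (real n))"
proof -
  let ?G = "{z \<in> G. \<bar>fst z\<bar> \<le> \<bar>snd z\<bar>}"
  define R where "R = (\<lambda>i. {j. (i, j) \<in> ?G})"
  have fin: "finite (R i)" for i
    by (rule finite_subset[of _ "{-int n..int n}"]) (use box in \<open>auto simp: R_def\<close>)
  have row: "real (card (R i)) \<le> 2 * (1 + D * real n / real_of_int \<bar>i\<bar>)" if i: "i \<noteq> 0" for i
  proof -
    have half: "real (card {j \<in> R i. e * j > 0}) \<le> 1 + D * real n / real_of_int \<bar>i\<bar>" if e: "e = 1 \<or> e = -1" for e :: int
    proof -
      let ?A = "{j \<in> R i. e * j > 0}"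
      have "card ?A = card ((*) e ` ?A)"
        by (rule card_image[symmetric]) (use e in \<open>auto simp: inj_on_def\<close>)
      moreover have "real (card ((*) e ` ?A)) \<le> 1 + D * real n / real_of_int \<bar>i\<bar>"
      proof (rule card_int_set_spread_le)
        fix x y assume "x \<in> (*) e ` ?A" "y \<in> (*) e ` ?A" and xy: "x < y"
        then obtain j j' where j: "j \<in> R i" "x = e * j" "x > 0" "j' \<in> R i" "y = e * j'" "y > 0" by auto
        have "\<bar>j\<bar> = x" "\<bar>j'\<bar> = y" "0 < j * j'" using e j by (auto simp: zero_less_mult_iff)
        with gap[of i j j'] j xy i have "of_int ((y - x) * \<bar>i\<bar>) \<le> D * real n" by (auto simp: R_def)
        then show "of_int (y - x) \<le> D * real n / real_of_int \<bar>i\<bar>" using i by (simp add: field_simps)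
      qed (use fin[of i] D in auto)
      ultimately show ?thesis by simp
    qed
    have "R i \<subseteq> {j \<in> R i. 1 * j > 0} \<union> {j \<in> R i. (-1) * j > 0}" using i by (auto simp: R_def)
    then have "card (R i) \<le> card ({j \<in> R i. 1 * j > 0} \<union> {j \<in> R i. (-1) * j > 0})"
      using fin[of i] by (intro card_mono) auto
    also have "\<dots> \<le> card {j \<in> R i. 1 * j > 0} + card {j \<in> R i. (-1) * j > 0}" by (rule card_Un_le)
    finally have "real (card (R i)) \<le> real (card {j \<in> R i. 1 * j > 0}) + real (card {j \<in> R i. (-1) * j > 0})"
      by linarith
    also have "\<dots> \<le> (1 + D * real n / real_of_int \<bar>i\<bar>) + (1 + D * real n / real_of_int \<bar>i\<bar>)"
      by (intro add_mono half) auto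
    finally show ?thesis by simp
  qed
  have row0: "real (card (R 0)) \<le> 2 * real n + 1"
  proof -
    have "card (R 0) \<le> card {-int n..int n}" using box by (intro card_mono) (auto simp: R_def)
    then show ?thesis by simp
  qed
  have "?G = Sigma {-int n..int n} R" using box by (auto simp: R_def)
  then have "card ?G = (\<Sum>i\<in>{-int n..int n}. card (R i))"
    using fin by (simp add: card_SigmaI)
  then have "real (card ?G) = (\<Sum>i\<in>{-int n..int n}. real (card (R i)))" by simp
  also have "{-int n..int n} = {0} \<union> (int ` {1..n} \<union> (\<lambda>k. - int k) ` {1..n})" (is "_ = _ \<union> (?P \<union> ?N)")
  proof -
    have "x \<in> int ` {1..n} \<or> x \<in> (\<lambda>k. - int k) ` {1..n}" if "-int n \<le> x" "x \<le> int n" "x \<noteq> 0" for x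
    proof (cases "x > 0")
      case True
      then have "x = int (nat x)" "nat x \<in> {1..n}" using that by auto
      then show ?thesis by blast
    next
      case False
      then have "x = - int (nat (-x))" "nat (-x) \<in> {1..n}" using that by auto
      then show ?thesis by blast
    qed
    then have "{-int n..int n} \<subseteq> {0} \<union> (?P \<union> ?N)" by fastforce
    moreover have "{0} \<union> (?P \<union> ?N) \<subseteq> {-int n..int n}" by auto
    ultimately show ?thesis by (rule subset_antisym)
  qed
  also have "(\<Sum>i\<in>{0} \<union> (?P \<union> ?N). real (card (R i))) = real (card (R 0)) + (\<Sum>i\<in>?P \<union> ?N. real (card (R i)))"
    by (subst sum.union_disjoint) auto
  also have "(\<Sum>i\<in>?P \<union> ?N. real (card (R i))) = (\<Sum>i\<in>?P. real (card (R i))) + (\<Sum>i\<in>?N. real (card (R i)))"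
    by (subst sum.union_disjoint) auto
  also have "(\<Sum>i\<in>?P. real (card (R i))) = (\<Sum>k=1..n. real (card (R (int k))))"
    by (subst sum.reindex) (auto simp: inj_on_def)
  also have "(\<Sum>i\<in>?N. real (card (R i))) = (\<Sum>k=1..n. real (card (R (- int k))))"
    by (subst sum.reindex) (auto simp: inj_on_def)
  also have "real (card (R 0)) + ((\<Sum>k=1..n. real (card (R (int k)))) + (\<Sum>k=1..n. real (card (R (- int k)))))
     \<le> (2 * real n + 1) + ((\<Sum>k=1..n. 2 * (1 + D * real n / real k)) + (\<Sum>k=1..n. 2 * (1 + D * real n / real k)))"
    using row0 row[of "int k" for k] row[of "- int k" for k] by (intro add_mono sum_mono) auto
  also have "\<dots> = 6 * real n + 1 + 4 * D * real n * (\<Sum>k=1..n. 1 / real k)"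
    by (simp add: sum.distrib sum_distrib_left algebra_simps)
  also have "\<dots> \<le> 6 * real n + 1 + 4 * D * real n * (1 + ln (real n))"
    using sum_inverse_le_ln[OF n] D by (intro add_left_mono mult_left_mono) auto
  also have "\<dots> \<le> 7 * real n * (1 + ln (real n)) + 4 * D * real n * (1 + ln (real n))"
  proof -
    have "7 * real n * 1 \<le> 7 * real n * (1 + ln (real n))" using n by (intro mult_left_mono) auto
    moreover have "1 \<le> real n" using n by simp
    ultimately show ?thesis by linarith
  qed
  finally show ?thesis by (simp add: algebra_simps)
qed

text \<open>The model is the set where i^2 - j^2 lies in a fixed window of length O(n): for fixed
  \<open>i\<close>, the difference (j' - j)(j' + j) is then O(n). The gap condition is needed only
  on the side of the diagonal where the varying coordinate is the larger one, so the set is split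
  along the diagonals and the other half is transposed.\<close>

lemma card_hyperbolic_set_le:
  fixes G :: "(int \<times> int) set" and D :: real and n :: nat
  assumes n: "n \<ge> 1" and D: "D \<ge> 0"
    and box: "G \<subseteq> {-int n..int n} \<times> {-int n..int n}"
    and gap1: "\<And>i j j'. (i, j) \<in> G \<Longrightarrow> (i, j') \<in> G \<Longrightarrow> i \<noteq> 0 \<Longrightarrow> 0 < j * j' \<Longrightarrow> \<bar>i\<bar> \<le> \<bar>j\<bar> \<Longrightarrow> \<bar>j\<bar> < \<bar>j'\<bar>
                \<Longrightarrow> of_int ((\<bar>j'\<bar> - \<bar>j\<bar>) * \<bar>i\<bar>) \<le> D * real n"
    and gap2: "\<And>i j j'. (j, i) \<in> G \<Longrightarrow> (j', i) \<in> G \<Longrightarrow> i \<noteq> 0 \<Longrightarrow> 0 < j * j' \<Longrightarrow> \<bar>i\<bar> \<le> \<bar>j\<bar> \<Longrightarrow> \<bar>j\<bar> < \<bar>j'\<bar>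
                \<Longrightarrow> of_int ((\<bar>j'\<bar> - \<bar>j\<bar>) * \<bar>i\<bar>) \<le> D * real n"
  shows "real (card G) \<le> (14 + 8 * D) * real n * (1 + ln (real n))"
proof -
  let ?H = "prod.swap ` G"
  have 1: "real (card {z \<in> G. \<bar>fst z\<bar> \<le> \<bar>snd z\<bar>}) \<le> (7 + 4 * D) * real n * (1 + ln (real n))"
    by (rule card_lower_part_le) fact+
  have 2: "real (card {z \<in> ?H. \<bar>fst z\<bar> \<le> \<bar>snd z\<bar>}) \<le> (7 + 4 * D) * real n * (1 + ln (real n))"
    by (rule card_lower_part_le) (use n D box gap2 in auto)
  have fin: "finite G" by (rule finite_subset[OF box]) auto
  have "G \<subseteq> {z \<in> G. \<bar>fst z\<bar> \<le> \<bar>snd z\<bar>} \<union> prod.swap ` {z \<in> ?H. \<bar>fst z\<bar> \<le> \<bar>snd z\<bar>}"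
  proof
    fix z assume z: "z \<in> G"
    show "z \<in> {z \<in> G. \<bar>fst z\<bar> \<le> \<bar>snd z\<bar>} \<union> prod.swap ` {z \<in> ?H. \<bar>fst z\<bar> \<le> \<bar>snd z\<bar>}"
    proof (cases "\<bar>fst z\<bar> \<le> \<bar>snd z\<bar>")
      case False
      then have "prod.swap z \<in> {z \<in> ?H. \<bar>fst z\<bar> \<le> \<bar>snd z\<bar>}" using z by auto
      then show ?thesis by (intro UnI2 image_eqI[of _ _ "prod.swap z"]) auto
    qed (use z in auto)
  qed
  then have "card G \<le> card ({z \<in> G. \<bar>fst z\<bar> \<le> \<bar>snd z\<bar>} \<union> prod.swap ` {z \<in> ?H. \<bar>fst z\<bar> \<le> \<bar>snd z\<bar>})"
    using fin by (intro card_mono) auto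
  also have "\<dots> \<le> card {z \<in> G. \<bar>fst z\<bar> \<le> \<bar>snd z\<bar>} + card (prod.swap ` {z \<in> ?H. \<bar>fst z\<bar> \<le> \<bar>snd z\<bar>})"
    by (rule card_Un_le)
  also have "card (prod.swap ` {z \<in> ?H. \<bar>fst z\<bar> \<le> \<bar>snd z\<bar>}) \<le> card {z \<in> ?H. \<bar>fst z\<bar> \<le> \<bar>snd z\<bar>}"
    using fin by (intro card_image_le) auto
  finally show ?thesis using 1 2 by (simp add: algebra_simps)
qed

text \<open>Pigeonhole: were all gaps at least \<open>g\<close>, the points would fall into distinct
  intervals of length \<open>g\<close>. There are at most \<open>l / g + 1\<close> =
  \<open>card A / 2 + 1\<close> of these, too few when \<open>card A\<close> \<ge> 3.\<close>

lemma exists_close_pair: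
  fixes A :: "real set"
  assumes "finite A" "A \<subseteq> {a..a + l}" "l > 0" "card A \<ge> 3"
  shows "\<exists>x\<in>A. \<exists>y\<in>A. x < y \<and> real (card A) * (y - x) < 2 * l"
proof (rule ccontr)
  assume *: "\<not> ?thesis"
  define g where "g = 2 * l / real (card A)"
  have g: "g > 0" using assms by (auto simp: g_def)
  have gap: "y - x \<ge> g" if "x \<in> A" "y \<in> A" "x < y" for x y
  proof -
    have "real (card A) * (y - x) \<ge> 2 * l" using * that by force
    then show ?thesis using assms(4) by (simp add: g_def field_simps)
  qed
  define f where "f = (\<lambda>x. \<lfloor>(x - a) / g\<rfloor>)"
  have "inj_on f A"
  proof (rule linorder_inj_onI')
    fix x y assume xy: "x \<in> A" "y \<in> A" "x < y"
    have "(x - a + g) / g \<le> (y - a) / g" using gap[OF xy] g by (intro divide_right_mono) auto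
    then have "(x - a) / g + 1 \<le> (y - a) / g" using g by (simp add: add_divide_distrib)
    then show "f x \<noteq> f y" unfolding f_def by linarith
  qed
  then have "card A = card (f ` A)" by (simp add: card_image)
  also have "f ` A \<subseteq> {0..\<lfloor>l / g\<rfloor>}"
  proof
    fix z assume "z \<in> f ` A"
    then obtain x where "x \<in> A" "z = f x" by auto
    then show "z \<in> {0..\<lfloor>l / g\<rfloor>}" using assms(2) g
      by (auto simp: f_def intro!: floor_mono divide_right_mono)
  qed
  then have "card (f ` A) \<le> card {0..\<lfloor>l / g\<rfloor>}" by (intro card_mono) auto
  also have "\<dots> = nat (\<lfloor>l / g\<rfloor> + 1)" by simp
  finally have "int (card A) \<le> \<lfloor>l / g\<rfloor> + 1" using assms(4) by linarith
  then have "real (card A) \<le> l / g + 1" by linarith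
  also have "l / g = real (card A) / 2" using assms by (simp add: g_def)
  finally show False using assms(4) by simp
qed

section \<open>Tangents of a curved profile\<close>

lemma floor_eq_imp_close:
  fixes s t M c :: real
  assumes "\<lfloor>s * M / c\<rfloor> = \<lfloor>t * M / c\<rfloor>" "c > 0" "M > 0"
  shows "\<bar>s - t\<bar> \<le> c / M"
proof -
  have "\<bar>s * M / c - t * M / c\<bar> \<le> 1" using assms(1) by linarith
  moreover have "s * M / c - t * M / c = (s - t) * (M / c)"
    by (simp add: left_diff_distrib diff_divide_distrib)
  ultimately have "\<bar>s - t\<bar> * (M / c) \<le> 1" using assms by (simp add: abs_mult)
  then show ?thesis using assms by (simp add: field_simps)
qed

text \<open>\<sigma> is the constant sign of \<mu>'', so that convex and concave profiles are
  treated together.\<close>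

locale curved_profile =
  fixes \<mu> \<mu>' \<mu>'' :: "real \<Rightarrow> real" and \<sigma> lo hi lam Lam :: real
  assumes deriv: "\<And>s. s \<in> {lo..hi} \<Longrightarrow> (\<mu> has_real_derivative \<mu>' s) (at s)"
    and deriv2: "\<And>s. s \<in> {lo..hi} \<Longrightarrow> (\<mu>' has_real_derivative \<mu>'' s) (at s)"
    and sgn: "\<bar>\<sigma>\<bar> = 1"
    and lam: "lam > 0" "Lam > 0"
    and curved: "\<And>s. s \<in> {lo..hi} \<Longrightarrow> lam \<le> \<sigma> * \<mu>'' s" "\<And>s. s \<in> {lo..hi} \<Longrightarrow> \<sigma> * \<mu>'' s \<le> Lam"
begin

text \<open>The tangent of \<mu> at \<open>s\<close>, evaluated at \<open>r\<close>. For g(x, y) = x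
  \<mu>(y / x), the number \<open>p1 * tang (p2 / p1) s\<close> is the differential of g along the
  ray of slope \<open>s\<close>, applied to (p1, p2). As a function of \<open>s\<close> it has
  derivative proportional to \<open>\<mu>'' s * (r - s)\<close>, hence a nondegenerate extremum at
  \<open>s = r\<close>.\<close>

definition tang :: "real \<Rightarrow> real \<Rightarrow> real" where
  "tang r s = \<mu> s + \<mu>' s * (r - s)"

lemma tang_self [simp]: "tang r r = \<mu> r"
  by (simp add: tang_def)

lemma deriv_tang:
  "s \<in> {lo..hi} \<Longrightarrow> (tang r has_real_derivative \<mu>'' s * (r - s)) (at s)"
  unfolding tang_def [abs_def]
  by (auto intro!: derivative_eq_intros deriv deriv2 simp: algebra_simps)

lemma tang_upper:
  assumes "s \<in> {lo..hi}" "s' \<in> {lo..hi}" "\<bar>s - r\<bar> \<le> d" "\<bar>s' - r\<bar> \<le> d"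
  shows "\<bar>tang r s - tang r s'\<bar> \<le> Lam * d * \<bar>s - s'\<bar>"
proof -
  have *: "\<bar>tang r v - tang r u\<bar> \<le> Lam * d * \<bar>v - u\<bar>"
    if uv: "u \<in> {lo..hi}" "v \<in> {lo..hi}" "u < v" "\<bar>u - r\<bar> \<le> d" "\<bar>v - r\<bar> \<le> d" for u v
  proof -
    obtain z where z: "u < z" "z < v" "tang r v - tang r u = (v - u) * (\<mu>'' z * (r - z))"
      using MVT2[of u v "tang r" "\<lambda>s. \<mu>'' s * (r - s)"] uv deriv_tang by auto
    have zJ: "z \<in> {lo..hi}" using z uv by auto
    have "\<bar>\<mu>'' z\<bar> = \<bar>\<sigma> * \<mu>'' z\<bar>" using sgn by (simp add: abs_mult)
    also have "\<dots> \<le> Lam" using curved[OF zJ] lam by auto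
    finally have "\<bar>\<mu>'' z\<bar> \<le> Lam" .
    moreover have "\<bar>r - z\<bar> \<le> d" using z uv by linarith
    ultimately have "\<bar>\<mu>'' z\<bar> * \<bar>r - z\<bar> \<le> Lam * d" by (intro mult_mono) auto
    then have "\<bar>v - u\<bar> * (\<bar>\<mu>'' z\<bar> * \<bar>r - z\<bar>) \<le> \<bar>v - u\<bar> * (Lam * d)" by (intro mult_left_mono) auto
    then show ?thesis using z(3) by (simp add: abs_mult mult_ac)
  qed
  consider "s < s'" | "s = s'" | "s' < s" by linarith
  then show ?thesis
    using *[of s s'] *[of s' s] assms by cases (auto simp: abs_minus_commute)
qed

lemma tang_error:
  assumes "s \<in> {lo..hi}" "r \<in> {lo..hi}"
  shows "\<bar>\<mu> r - tang r s\<bar> \<le> Lam * (r - s)\<^sup>2"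
  using tang_upper[of r s r "\<bar>r - s\<bar>"] assms by (simp add: abs_minus_commute power2_eq_square)

text \<open>Adding \<open>lam / 2 * (s - r)\<^sup>2\<close> to \<open>\<sigma> * tang r s\<close>
  leaves the derivative \<open>(\<sigma> * \<mu>'' s - lam) * (r - s)\<close>, so the sum still
  decreases when \<open>s\<close> moves away from \<open>r\<close> on either side.\<close>

lemma tang_lower:
  assumes "s \<in> {lo..hi}" "s' \<in> {lo..hi}" and side: "r \<le> s' \<and> s' \<le> s \<or> s \<le> s' \<and> s' \<le> r"
  shows "lam / 2 * ((s - r)\<^sup>2 - (s' - r)\<^sup>2) \<le> \<bar>tang r s - tang r s'\<bar>"
proof -
  define g where "g = (\<lambda>s. \<sigma> * tang r s + lam / 2 * (s - r)\<^sup>2)"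
  have dg: "(g has_real_derivative (\<sigma> * \<mu>'' z - lam) * (r - z)) (at z)" if "z \<in> {lo..hi}" for z
    unfolding g_def
    by (auto intro!: derivative_eq_intros deriv_tang that simp: field_simps)
  have "g s \<le> g s'"
    using side
  proof
    assume a: "r \<le> s' \<and> s' \<le> s"
    show ?thesis
    proof (rule DERIV_nonpos_imp_nonincreasing[where f = g and a = s' and b = s])
      fix x assume x: "s' \<le> x" "x \<le> s"
      then have xJ: "x \<in> {lo..hi}" using assms by auto
      have "(\<sigma> * \<mu>'' x - lam) * (r - x) \<le> 0"
        using curved[OF xJ] x a by (intro mult_nonneg_nonpos) auto
      then show "\<exists>y. (g has_real_derivative y) (at x) \<and> y \<le> 0" using dg[OF xJ] by blast
    qed (use a in auto)
  next
    assume a: "s \<le> s' \<and> s' \<le> r"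
    show ?thesis
    proof (rule DERIV_nonneg_imp_nondecreasing[where f = g and a = s and b = s'])
      fix x assume x: "s \<le> x" "x \<le> s'"
      then have xJ: "x \<in> {lo..hi}" using assms by auto
      have "(\<sigma> * \<mu>'' x - lam) * (r - x) \<ge> 0"
        using curved[OF xJ] x a by (intro mult_nonneg_nonneg) auto
      then show "\<exists>y. (g has_real_derivative y) (at x) \<and> y \<ge> 0" using dg[OF xJ] by blast
    qed (use a in auto)
  qed
  then have "lam / 2 * ((s - r)\<^sup>2 - (s' - r)\<^sup>2) \<le> \<sigma> * (tang r s' - tang r s)"
    by (simp add: g_def algebra_simps)
  also have "\<dots> \<le> \<bar>\<sigma> * (tang r s' - tang r s)\<bar>" by simp
  also have "\<dots> = \<bar>tang r s - tang r s'\<bar>" using sgn by (simp add: abs_mult abs_minus_commute)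
  finally show ?thesis .
qed

text \<open>Here \<open>s\<close>, \<open>t\<close> lie on a grid of mesh \<open>c / M\<close> and \<open>q * tang r s\<close> is within \<open>O(1 / M)\<close> of
  \<open>q' * tang r' t\<close>. Since \<open>r'\<close> is a nondegenerate extremum of \<open>tang r'\<close>, two values of \<open>t\<close> that
  belong to the same \<open>s\<close> can be far apart in the grid only if they are close to \<open>r'\<close>.\<close>

lemma row_gap:
  fixes q q' M c a e :: real and i j j' :: int
  assumes pos: "q > 0" "q' > 0" "M > 0" "c > 0" "a > 0" "e > 0"
    and J: "s \<in> {lo..hi}" "s' \<in> {lo..hi}" "t \<in> {lo..hi}" "t' \<in> {lo..hi}"
    and near: "\<bar>s - r\<bar> \<le> a / q" "\<bar>s' - r\<bar> \<le> a / q"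
    and cells: "\<lfloor>s * M / c\<rfloor> = \<lfloor>s' * M / c\<rfloor>"
    and j: "j = \<lfloor>t * M / c\<rfloor> - \<lfloor>r' * M / c\<rfloor>" "j' = \<lfloor>t' * M / c\<rfloor> - \<lfloor>r' * M / c\<rfloor>"
    and rel: "\<bar>q * tang r s - q' * tang r' t\<bar> \<le> e / M" "\<bar>q * tang r s' - q' * tang r' t'\<bar> \<le> e / M"
    and sign: "0 < j * j'" "\<bar>j\<bar> < \<bar>j'\<bar>"
  shows "of_int ((\<bar>j'\<bar> - \<bar>j\<bar> - 1) * (\<bar>j'\<bar> - 1)) \<le> 2 * (2 * e + Lam * a * c) / (lam * c\<^sup>2) * (M / q')"
proof -
  have ss': "\<bar>s - s'\<bar> \<le> c / M" using cells pos by (intro floor_eq_imp_close) auto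
  \<comment> \<open>Within distance \<open>a / q\<close> of its extremum, \<open>tang r\<close> has
    derivative O(1 / q). This cancels the factor \<open>q\<close>, so moving \<open>s\<close> inside
    its cell changes \<open>q * tang r s\<close> by only O(1 / M).\<close>
  have "\<bar>tang r s - tang r s'\<bar> \<le> Lam * (a / q) * \<bar>s - s'\<bar>" by (intro tang_upper J near)
  also have "\<dots> \<le> Lam * (a / q) * (c / M)" using ss' lam pos by (intro mult_left_mono) auto
  finally have "q * \<bar>tang r s - tang r s'\<bar> \<le> q * (Lam * (a / q) * (c / M))"
    using pos by (intro mult_left_mono) auto
  then have *: "\<bar>q * (tang r s - tang r s')\<bar> \<le> Lam * a * c / M"
    using pos by (simp add: abs_mult)
  have "\<bar>q' * tang r' t' - q' * tang r' t\<bar> \<le> (2 * e + Lam * a * c) / M"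
  proof -
    have "(2 * e + Lam * a * c) / M = 2 * (e / M) + Lam * a * c / M"
      by (simp add: add_divide_distrib)
    moreover have "\<bar>q * tang r s - q * tang r s'\<bar> \<le> Lam * a * c / M"
      using * by (simp add: right_diff_distrib)
    ultimately show ?thesis using rel by linarith
  qed
  then have tt: "q' * \<bar>tang r' t' - tang r' t\<bar> \<le> (2 * e + Lam * a * c) / M"
    using pos by (simp add: abs_mult flip: right_diff_distrib)
  define h where "h = c / M"
  have h: "h > 0" using pos by (simp add: h_def)
  have cell: "of_int \<lfloor>x * M / c\<rfloor> * h \<le> x" "x < (of_int \<lfloor>x * M / c\<rfloor> + 1) * h" for x
  proof -
    have "of_int \<lfloor>x * M / c\<rfloor> \<le> x / h" "x / h < of_int \<lfloor>x * M / c\<rfloor> + 1"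
      unfolding h_def using pos by (simp_all add: floor_correct)
    then show "of_int \<lfloor>x * M / c\<rfloor> * h \<le> x" "x < (of_int \<lfloor>x * M / c\<rfloor> + 1) * h"
      using h by (simp_all add: field_simps)
  qed
  have fl: "\<lfloor>t * M / c\<rfloor> = j + \<lfloor>r' * M / c\<rfloor>" "\<lfloor>t' * M / c\<rfloor> = j' + \<lfloor>r' * M / c\<rfloor>" using j by auto
  \<comment> \<open>Equal signs of \<open>j\<close> and \<open>j'\<close> put \<open>t\<close> and
    \<open>t'\<close> on the same side of \<open>r'\<close>, with \<open>t\<close> the closer one.
    Each subtracted 1 is the loss from rounding two points to the grid. Below, the two bounds are
    multiplied and the product is compared with the factors of
    \<open>(t' - r')\<^sup>2 - (t - r')\<^sup>2\<close>.\<close>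
  have key: "(\<bar>j'\<bar> - \<bar>j\<bar> - 1) * h \<le> \<bar>t' - r'\<bar> - \<bar>t - r'\<bar> \<and> (\<bar>j'\<bar> - 1) * h \<le> \<bar>t' - r'\<bar>
        \<and> (r' \<le> t \<and> t \<le> t' \<or> t' \<le> t \<and> t \<le> r')"
  proof (cases "j > 0")
    case True
    then have j': "j' > j" using sign by (auto simp: zero_less_mult_iff)
    have 1: "of_int (j + \<lfloor>r' * M / c\<rfloor>) * h \<le> t" "t < (of_int (j + \<lfloor>r' * M / c\<rfloor>) + 1) * h"
      "of_int (j' + \<lfloor>r' * M / c\<rfloor>) * h \<le> t'" "r' < (of_int \<lfloor>r' * M / c\<rfloor> + 1) * h"
      using cell[of t] cell[of t'] cell[of r'] fl by auto
    have 0: "1 * h \<le> of_int j * h" "(of_int j + 1) * h \<le> of_int j' * h"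
      using True j' h by (intro mult_right_mono; linarith)+
    note expanded = 0[unfolded distrib_right mult_1_left] 1[unfolded of_int_add distrib_right mult_1_left]
    have 2: "r' \<le> t" "t \<le> t'" using expanded by linarith+
    then show ?thesis using 1 True j' by (auto simp: algebra_simps)
  next
    case False
    then have j': "j < 0" "j' < j" using sign by (auto simp: zero_less_mult_iff)
    have 1: "of_int (j + \<lfloor>r' * M / c\<rfloor>) * h \<le> t" "t < (of_int (j + \<lfloor>r' * M / c\<rfloor>) + 1) * h"
      "t' < (of_int (j' + \<lfloor>r' * M / c\<rfloor>) + 1) * h" "of_int \<lfloor>r' * M / c\<rfloor> * h \<le> r'"
      using cell[of t] cell[of t'] cell[of r'] fl by auto
    have 0: "(of_int j + 1) * h \<le> 0 * h" "(of_int j' + 1) * h \<le> of_int j * h"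
      using j' h by (intro mult_right_mono; linarith)+
    note expanded = 0[unfolded distrib_right mult_1_left mult_zero_left]
      1[unfolded of_int_add distrib_right mult_1_left]
    have 2: "t \<le> r'" "t' \<le> t" using expanded by linarith+
    then show ?thesis using 1 j' by (auto simp: algebra_simps)
  qed
  have "((\<bar>j'\<bar> - \<bar>j\<bar> - 1) * h) * ((\<bar>j'\<bar> - 1) * h) \<le> (\<bar>t' - r'\<bar> - \<bar>t - r'\<bar>) * (\<bar>t' - r'\<bar> + \<bar>t - r'\<bar>)"
    using key h sign by (intro mult_mono) (auto intro!: mult_nonneg_nonneg)
  also have "\<dots> = (t' - r')\<^sup>2 - (t - r')\<^sup>2"
    by (simp add: square_diff_square_factored power2_eq_square algebra_simps flip: abs_mult)
  finally have "lam / 2 * (((\<bar>j'\<bar> - \<bar>j\<bar> - 1) * h) * ((\<bar>j'\<bar> - 1) * h)) \<le> lam / 2 * ((t' - r')\<^sup>2 - (t - r')\<^sup>2)"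
    using lam by (intro mult_left_mono) auto
  also have "\<dots> \<le> \<bar>tang r' t' - tang r' t\<bar>" using key by (intro tang_lower J) auto
  also have "\<dots> \<le> (2 * e + Lam * a * c) / M / q'" using tt pos by (simp add: field_simps)
  finally have "lam / 2 * (((\<bar>j'\<bar> - \<bar>j\<bar> - 1) * h) * ((\<bar>j'\<bar> - 1) * h)) \<le> (2 * e + Lam * a * c) / M / q'" .
  moreover define X where "X = real_of_int ((\<bar>j'\<bar> - \<bar>j\<bar> - 1) * (\<bar>j'\<bar> - 1))"
  ultimately have "X * (lam / 2 * h\<^sup>2) \<le> (2 * e + Lam * a * c) / M / q'"
    by (simp add: power2_eq_square mult_ac)
  then have "X \<le> (2 * e + Lam * a * c) / M / q' / (lam / 2 * h\<^sup>2)"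
    by (subst pos_le_divide_eq) (use lam h in auto)
  also have "\<dots> = 2 * (2 * e + Lam * a * c) / (lam * c\<^sup>2) * (M / q')"
    using lam pos by (simp add: h_def field_simps power2_eq_square)
  finally show ?thesis by (simp add: X_def)
qed

end

section \<open>Counting the cells that share a difference\<close>

context curved_profile
begin

lemma scaled_floor_diff_le:
  fixes q M c a :: real
  assumes pos: "q > 0" "M > 0" "c > 0" and "\<bar>s - r\<bar> \<le> a / q"
  shows "real_of_int \<bar>\<lfloor>s * M / c\<rfloor> - \<lfloor>r * M / c\<rfloor>\<bar> \<le> a / c * (M / q) + 1"
proof -
  have "\<bar>s * M / c - r * M / c\<bar> = \<bar>s - r\<bar> * (M / c)"
  proof -
    have "s * M / c - r * M / c = (s - r) * (M / c)"
      by (simp add: left_diff_distrib diff_divide_distrib)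
    then show ?thesis using pos by (simp add: abs_mult)
  qed
  also have "\<dots> \<le> a / q * (M / c)" using assms by (intro mult_right_mono) auto
  finally have "\<bar>s * M / c - r * M / c\<bar> \<le> a / c * (M / q)" by (simp add: mult_ac)
  moreover have "\<bar>real_of_int \<lfloor>u\<rfloor> - real_of_int \<lfloor>v\<rfloor>\<bar> \<le> \<bar>u - v\<bar> + 1" for u v :: real
    using floor_correct[of u] floor_correct[of v] by linarith
  from this[of "s * M / c" "r * M / c"]
  have "\<bar>real_of_int \<lfloor>s * M / c\<rfloor> - real_of_int \<lfloor>r * M / c\<rfloor>\<bar> \<le> \<bar>s * M / c - r * M / c\<bar> + 1" .
  ultimately show ?thesis by simp
qed

text \<open>Here \<open>q\<close>, \<open>q'\<close> are the scales and \<open>r\<close>,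
  \<open>r'\<close> the slopes of a fixed difference, and \<open>H\<close> consists of cells
  compatible with it. They lie in a box of side O(M / q) around the cell of (r, r').
  \<open>row_gap\<close>, used once as it stands and once with the two points exchanged, supplies
  both gap conditions of \<open>card_hyperbolic_set_le\<close>. The constant is uniform in
  \<open>r\<close> and \<open>r'\<close>, which may be any reals.\<close>

lemma card_cells_le:
  fixes \<Gamma> c a e :: real
  assumes pos: "\<Gamma> \<ge> 1" "c > 0" "a > 0" "e > 0"
  shows "\<exists>C>0. \<forall>q q' M r r' H. q > 0 \<longrightarrow> q' > 0 \<longrightarrow> q \<le> M \<longrightarrow> q \<le> \<Gamma> * q' \<longrightarrow> q' \<le> \<Gamma> * q \<longrightarrow>
           (\<forall>z\<in>H. \<exists>s\<in>{lo..hi}. \<exists>t\<in>{lo..hi}. z = (\<lfloor>s * M / c\<rfloor>, \<lfloor>t * M / c\<rfloor>) \<and>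
               \<bar>s - r\<bar> \<le> a / q \<and> \<bar>t - r'\<bar> \<le> a / q' \<and> \<bar>q * tang r s - q' * tang r' t\<bar> \<le> e / M) \<longrightarrow>
           real (card H) \<le> C * (M / q * (1 + ln (M / q)))"
proof -
  define A where "A = \<Gamma> * a / c + 3"
  define D0 where "D0 = 2 * (2 * e + Lam * a * c) / (lam * c\<^sup>2) * \<Gamma>"
  define D where "D = D0 + 1"
  have A: "A > 1" using pos by (auto simp: A_def intro!: add_nonneg_pos)
  have D0: "D0 \<ge> 0" using pos lam by (auto simp: D0_def)
  show ?thesis
  proof (intro exI[of _ "(14 + 8 * D) * A * (1 + ln A)"] conjI allI impI)
    show "(14 + 8 * D) * A * (1 + ln A) > 0" using A D0 by (intro mult_pos_pos) (auto simp: D_def add_pos_pos)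
    fix q q' M r r' :: real and H :: "(int \<times> int) set"
    assume q: "q > 0" "q' > 0" "q \<le> M" "q \<le> \<Gamma> * q'" "q' \<le> \<Gamma> * q"
      and H: "\<forall>z\<in>H. \<exists>s\<in>{lo..hi}. \<exists>t\<in>{lo..hi}. z = (\<lfloor>s * M / c\<rfloor>, \<lfloor>t * M / c\<rfloor>) \<and>
               \<bar>s - r\<bar> \<le> a / q \<and> \<bar>t - r'\<bar> \<le> a / q' \<and> \<bar>q * tang r s - q' * tang r' t\<bar> \<le> e / M"
    have M: "M > 0" using q by linarith
    define x where "x = M / q"
    have x: "x \<ge> 1" using q by (simp add: x_def)
    have x': "M / q' \<le> \<Gamma> * x" "M / q \<le> \<Gamma> * x" using q M pos by (simp_all add: x_def field_simps)
    have inv: "a / q' \<le> \<Gamma> * a / q" "a / q \<le> \<Gamma> * a / q" using q pos by (auto simp: field_simps)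
    have n0: "\<Gamma> * a / c * x \<ge> 0" using pos x by simp
    \<comment> \<open>The 1 pays for rounding in \<open>scaled_floor_diff_le\<close>; the summand
      \<open>x\<close> ensures \<open>x\<close> \<le> \<open>n\<close>, so that a bound
      \<open>D0 * x\<close> becomes \<open>D0 * n\<close>.\<close>
    define n where "n = nat \<lceil>\<Gamma> * a / c * x + x + 1\<rceil>"
    have n: "\<Gamma> * a / c * x + x + 1 \<le> real n" unfolding n_def by linarith
    have n1: "n \<ge> 1" "x \<le> real n" using n n0 x by linarith+
    have nA: "real n \<le> A * x"
    proof -
      have "real n \<le> \<Gamma> * a / c * x + x + 1 + 1" unfolding n_def using n0 x by linarith
      also have "\<dots> \<le> A * x" using x by (simp add: A_def algebra_simps)
      finally show ?thesis .
    qed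
    define i0 where "i0 = \<lfloor>r * M / c\<rfloor>"
    define j0 where "j0 = \<lfloor>r' * M / c\<rfloor>"
    define G where "G = (\<lambda>(i, j). (i - i0, j - j0)) ` H"
    have GE: "\<exists>s\<in>{lo..hi}. \<exists>t\<in>{lo..hi}. i = \<lfloor>s * M / c\<rfloor> - i0 \<and> j = \<lfloor>t * M / c\<rfloor> - j0 \<and>
               \<bar>s - r\<bar> \<le> a / q \<and> \<bar>t - r'\<bar> \<le> a / q' \<and> \<bar>q * tang r s - q' * tang r' t\<bar> \<le> e / M"
      if "(i, j) \<in> G" for i j
      using that H unfolding G_def by fastforce
    have bd: "\<bar>i\<bar> \<le> int n \<and> \<bar>j\<bar> \<le> int n" if ij: "(i, j) \<in> G" for i j
    proof -
      obtain s t where st: "i = \<lfloor>s * M / c\<rfloor> - i0" "j = \<lfloor>t * M / c\<rfloor> - j0" "\<bar>s - r\<bar> \<le> a / q" "\<bar>t - r'\<bar> \<le> a / q'"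
        using GE[OF ij] by blast
      have "real_of_int \<bar>i\<bar> \<le> \<Gamma> * a / c * (M / q) + 1"
        unfolding st i0_def using st inv q M pos by (intro scaled_floor_diff_le) auto
      moreover have "real_of_int \<bar>j\<bar> \<le> \<Gamma> * a / c * (M / q) + 1"
        unfolding st j0_def using st inv q M pos by (intro scaled_floor_diff_le) auto
      ultimately show ?thesis using n x unfolding x_def by linarith
    qed
    \<comment> \<open>This removes the rounding losses of \<open>row_gap\<close>: since |i| \<le>
      |j| \<le> |j'| - 1, restoring the 1 in the first factor costs at most |i| \<le> n. Hence
      \<open>D = D0 + 1\<close>.\<close>
    have fin: "real_of_int ((\<bar>j'\<bar> - \<bar>j\<bar>) * \<bar>i\<bar>) \<le> D * real n"
      if gap: "real_of_int ((\<bar>j'\<bar> - \<bar>j\<bar> - 1) * (\<bar>j'\<bar> - 1)) \<le> D0 * x" and ij: "\<bar>i\<bar> \<le> \<bar>j\<bar>" "\<bar>j\<bar> < \<bar>j'\<bar>" "\<bar>i\<bar> \<le> int n"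
      for i j j' :: int
    proof -
      have "(\<bar>j'\<bar> - \<bar>j\<bar> - 1) * \<bar>i\<bar> \<le> (\<bar>j'\<bar> - \<bar>j\<bar> - 1) * (\<bar>j'\<bar> - 1)"
        using ij by (intro mult_left_mono) auto
      then have "(\<bar>j'\<bar> - \<bar>j\<bar>) * \<bar>i\<bar> \<le> (\<bar>j'\<bar> - \<bar>j\<bar> - 1) * (\<bar>j'\<bar> - 1) + int n"
        using ij by (simp add: algebra_simps)
      then have "real_of_int ((\<bar>j'\<bar> - \<bar>j\<bar>) * \<bar>i\<bar>) \<le> real_of_int ((\<bar>j'\<bar> - \<bar>j\<bar> - 1) * (\<bar>j'\<bar> - 1)) + real n"
        by linarith
      also have "\<dots> \<le> D0 * real n + real n"
        using gap mult_left_mono[OF n1(2) D0] by linarith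
      finally show ?thesis by (simp add: D_def algebra_simps)
    qed
    have coef: "2 * (2 * e + Lam * a * c) / (lam * c\<^sup>2) * (M / q') \<le> D0 * x"
               "2 * (2 * e + Lam * a * c) / (lam * c\<^sup>2) * (M / q) \<le> D0 * x"
      using mult_left_mono[OF x'(1), of "2 * (2 * e + Lam * a * c) / (lam * c\<^sup>2)"]
        mult_left_mono[OF x'(2), of "2 * (2 * e + Lam * a * c) / (lam * c\<^sup>2)"] pos lam
      by (simp_all add: D0_def mult_ac)
    have "real (card G) \<le> (14 + 8 * D) * real n * (1 + ln (real n))"
    proof (rule card_hyperbolic_set_le)
      show "D \<ge> 0" using D0 by (simp add: D_def)
      show "G \<subseteq> {-int n..int n} \<times> {-int n..int n}" using bd by (force simp: abs_le_iff)
      fix i j j' :: int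
      assume *: "i \<noteq> 0" "0 < j * j'" "\<bar>i\<bar> \<le> \<bar>j\<bar>" "\<bar>j\<bar> < \<bar>j'\<bar>"
      show "of_int ((\<bar>j'\<bar> - \<bar>j\<bar>) * \<bar>i\<bar>) \<le> D * real n" if ij: "(i, j) \<in> G" "(i, j') \<in> G"
      proof (rule fin)
        obtain s t where st: "s \<in> {lo..hi}" "t \<in> {lo..hi}" "i = \<lfloor>s * M / c\<rfloor> - i0" "j = \<lfloor>t * M / c\<rfloor> - j0"
          "\<bar>s - r\<bar> \<le> a / q" "\<bar>t - r'\<bar> \<le> a / q'" "\<bar>q * tang r s - q' * tang r' t\<bar> \<le> e / M"
          using GE[OF ij(1)] by blast
        obtain s' t' where st': "s' \<in> {lo..hi}" "t' \<in> {lo..hi}" "i = \<lfloor>s' * M / c\<rfloor> - i0" "j' = \<lfloor>t' * M / c\<rfloor> - j0"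
          "\<bar>s' - r\<bar> \<le> a / q" "\<bar>t' - r'\<bar> \<le> a / q'" "\<bar>q * tang r s' - q' * tang r' t'\<bar> \<le> e / M"
          using GE[OF ij(2)] by blast
        have "of_int ((\<bar>j'\<bar> - \<bar>j\<bar> - 1) * (\<bar>j'\<bar> - 1)) \<le> 2 * (2 * e + Lam * a * c) / (lam * c\<^sup>2) * (M / q')"
        proof (rule row_gap)
          show "\<lfloor>s * M / c\<rfloor> = \<lfloor>s' * M / c\<rfloor>" using st(3) st'(3) by linarith
          show "j = \<lfloor>t * M / c\<rfloor> - \<lfloor>r' * M / c\<rfloor>" "j' = \<lfloor>t' * M / c\<rfloor> - \<lfloor>r' * M / c\<rfloor>"
            using st(4) st'(4) by (simp_all only: j0_def)
        qed (fact q M pos st st' *)+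
        then show "of_int ((\<bar>j'\<bar> - \<bar>j\<bar> - 1) * (\<bar>j'\<bar> - 1)) \<le> D0 * x" using coef by linarith
      qed (use * bd[OF ij(1)] in auto)
      show "of_int ((\<bar>j'\<bar> - \<bar>j\<bar>) * \<bar>i\<bar>) \<le> D * real n" if ij: "(j, i) \<in> G" "(j', i) \<in> G"
      proof (rule fin)
        obtain s t where st: "s \<in> {lo..hi}" "t \<in> {lo..hi}" "j = \<lfloor>s * M / c\<rfloor> - i0" "i = \<lfloor>t * M / c\<rfloor> - j0"
          "\<bar>s - r\<bar> \<le> a / q" "\<bar>t - r'\<bar> \<le> a / q'" "\<bar>q * tang r s - q' * tang r' t\<bar> \<le> e / M"
          using GE[OF ij(1)] by blast
        obtain s' t' where st': "s' \<in> {lo..hi}" "t' \<in> {lo..hi}" "j' = \<lfloor>s' * M / c\<rfloor> - i0" "i = \<lfloor>t' * M / c\<rfloor> - j0"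
          "\<bar>s' - r\<bar> \<le> a / q" "\<bar>t' - r'\<bar> \<le> a / q'" "\<bar>q * tang r s' - q' * tang r' t'\<bar> \<le> e / M"
          using GE[OF ij(2)] by blast
        have "of_int ((\<bar>j'\<bar> - \<bar>j\<bar> - 1) * (\<bar>j'\<bar> - 1)) \<le> 2 * (2 * e + Lam * a * c) / (lam * c\<^sup>2) * (M / q)"
        proof (rule row_gap)
          show "\<lfloor>t * M / c\<rfloor> = \<lfloor>t' * M / c\<rfloor>" using st(4) st'(4) by linarith
          show "j = \<lfloor>s * M / c\<rfloor> - \<lfloor>r * M / c\<rfloor>" "j' = \<lfloor>s' * M / c\<rfloor> - \<lfloor>r * M / c\<rfloor>"
            using st(3) st'(3) by (simp_all only: i0_def)
          show "\<bar>q' * tang r' t - q * tang r s\<bar> \<le> e / M" "\<bar>q' * tang r' t' - q * tang r s'\<bar> \<le> e / M"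
            using st(7) st'(7) by (simp_all only: abs_minus_commute)
        qed (fact q M pos st st' *)+
        then show "of_int ((\<bar>j'\<bar> - \<bar>j\<bar> - 1) * (\<bar>j'\<bar> - 1)) \<le> D0 * x" using coef by linarith
      qed (use * bd[OF ij(1)] in auto)
    qed (rule n1)
    also have "card G = card H"
      unfolding G_def by (rule card_image) (auto simp: inj_on_def)
    also have "(14 + 8 * D) * real n * (1 + ln (real n)) \<le> (14 + 8 * D) * (A * x) * (1 + ln (A * x))"
      using nA n1 D0 by (intro mult_mono) (auto simp: D_def)
    also have "1 + ln (A * x) \<le> (1 + ln A) * (1 + ln x)"
      using A x by (simp add: ln_mult algebra_simps)
    then have "(14 + 8 * D) * (A * x) * (1 + ln (A * x)) \<le> (14 + 8 * D) * (A * x) * ((1 + ln A) * (1 + ln x))"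
      using A x D0 by (intro mult_left_mono) (auto simp: D_def)
    finally show "real (card H) \<le> (14 + 8 * D) * A * (1 + ln A) * (M / q * (1 + ln (M / q)))"
      by (simp add: x_def mult_ac)
  qed
qed

end

section \<open>Differences of near coincidences\<close>

lemma abs_diff_chain:
  fixes X Y U V P Q h k :: real
  assumes "\<bar>X - Y\<bar> \<le> h" "\<bar>U - V\<bar> \<le> h" "\<bar>X - U - P\<bar> \<le> k" "\<bar>Y - V - Q\<bar> \<le> k"
  shows "\<bar>P - Q\<bar> \<le> 2 * h + 2 * k"
  using assms by linarith

text \<open>\<Gamma> bounds the ratio of the scales of the two points of a solution. The requirement
  \<open>2 * B / b\<close> \<le> \<Gamma> makes this bound reproduce itself: it is the ratio that
  \<open>difference_near_equal\<close> obtains for a difference of two solutions.\<close>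

locale curved_arc = curved_profile +
  fixes \<rho>0 \<rho>1 \<kappa> b B L \<Gamma> :: real
  assumes ends: "lo = \<rho>0 - \<kappa>" "hi = \<rho>1 + \<kappa>"
    and kappa: "0 < \<kappa>" "\<kappa> \<le> 1 / 2"
    and b: "0 < b" and L: "0 < L" and \<Gamma>: "1 \<le> \<Gamma>" "2 * B / b \<le> \<Gamma>"
    and bounds: "\<And>s. s \<in> {lo..hi} \<Longrightarrow> b \<le> \<mu> s" "\<And>s. s \<in> {lo..hi} \<Longrightarrow> \<mu> s \<le> B"
    and lipschitz: "\<And>s t. s \<in> {lo..hi} \<Longrightarrow> t \<in> {lo..hi} \<Longrightarrow> \<bar>\<mu> s - \<mu> t\<bar> \<le> L * \<bar>s - t\<bar>"
begin

definition gauge :: "real \<Rightarrow> real \<Rightarrow> real" where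
  "gauge x y = x * \<mu> (y / x)"

text \<open>The admissible sector is widened by the additive constant \<open>\<kappa>\<close>: on the slopes its effect is of
  size \<open>\<kappa> / x\<close>, so that it grows as the scale decreases and absorbs the loss in each descent step.\<close>

definition in_sector :: "real \<Rightarrow> real \<Rightarrow> bool" where
  "in_sector x y \<longleftrightarrow> 1 \<le> x \<and> \<rho>0 * x - \<kappa> \<le> y \<and> y \<le> \<rho>1 * x + \<kappa>"

definition near_equal :: "real \<Rightarrow> real \<Rightarrow> real \<Rightarrow> real \<Rightarrow> real \<Rightarrow> bool" where
  "near_equal e x1 x2 y1 y2 \<longleftrightarrow> in_sector x1 x2 \<and> in_sector y1 y2 \<and> x1 \<le> \<Gamma> * y1 \<and> y1 \<le> \<Gamma> * x1 \<and>
     \<bar>gauge x1 x2 - gauge y1 y2\<bar> \<le> e"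

text \<open>Solutions in the unshifted integer lattice. Differences of points of a translate always
  lie there, so the recursion runs over these sets whatever the shifts of the original problem
  are.\<close>

definition shell :: "real \<Rightarrow> nat \<Rightarrow> (int \<times> int \<times> int \<times> int) set" where
  "shell \<eta> i = {(a, b, c, d). 2 ^ i \<le> real_of_int a \<and> real_of_int a < 2 ^ Suc i \<and>
      near_equal (\<eta> / of_int a) (of_int a) (of_int b) (of_int c) (of_int d)}"

lemma slope_in_range: "in_sector x y \<Longrightarrow> y / x \<in> {lo..hi}"
proof -
  assume *: "in_sector x y"
  then have x: "x \<ge> 1" by (simp add: in_sector_def)
  have "\<kappa> \<le> \<kappa> * x" using x kappa by simp
  then have "(\<rho>0 - \<kappa>) * x \<le> y" "y \<le> (\<rho>1 + \<kappa>) * x" using * by (auto simp: in_sector_def algebra_simps)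
  then show ?thesis using x by (simp add: ends field_simps)
qed

lemma slope_deviation:
  fixes x1 x2 u1 u2 c N M :: real
  assumes "x1 > 0" "u1 > 0" "\<bar>x2 / x1 - u2 / u1\<bar> \<le> c / M" "u1 \<le> N * M" "c > 0" "M > 0"
  shows "\<bar>(x2 - u2) - x2 / x1 * (x1 - u1)\<bar> \<le> c * N"
proof -
  have "(x2 - u2) - x2 / x1 * (x1 - u1) = (x2 / x1 - u2 / u1) * u1"
    using assms by (simp add: field_simps)
  then have "\<bar>(x2 - u2) - x2 / x1 * (x1 - u1)\<bar> = \<bar>x2 / x1 - u2 / u1\<bar> * u1"
    using assms by (simp add: abs_mult)
  also have "\<dots> \<le> c / M * (N * M)" using assms by (intro mult_mono) auto
  finally show ?thesis using assms by simp
qed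

text \<open>Both bounds come from exact identities. Write s, r for the slopes of x, u. In the first,
  the remainder is u1 (\<mu>(s) - \<mu>(r)), of size O(1). In the second, g is replaced by its
  linearization along the ray of x, which is exact at x; the remainder is minus u1 times the tangent
  error at r, quadratic in s - r, and thus O(1 / M).\<close>

lemma gauge_diff:
  fixes x1 x2 u1 u2 c N M :: real
  assumes x: "in_sector x1 x2" and u: "in_sector u1 u2"
    and close: "\<bar>x2 / x1 - u2 / u1\<bar> \<le> c / M" "u1 \<le> N * M" "c > 0" "M > 0"
  shows "\<bar>gauge x1 x2 - gauge u1 u2 - (x1 - u1) * \<mu> (x2 / x1)\<bar> \<le> N * L * c"
    and "x1 \<noteq> u1 \<Longrightarrow> \<bar>gauge x1 x2 - gauge u1 u2 - (x1 - u1) * tang ((x2 - u2) / (x1 - u1)) (x2 / x1)\<bar>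
           \<le> N * Lam * c\<^sup>2 / M"
proof -
  define s where "s = x2 / x1"
  define r where "r = u2 / u1"
  have pos: "x1 > 0" "u1 > 0" using x u by (auto simp: in_sector_def)
  have J: "s \<in> {lo..hi}" "r \<in> {lo..hi}" using x u by (auto simp only: s_def r_def slope_in_range)
  have "gauge x1 x2 - gauge u1 u2 - (x1 - u1) * \<mu> s = u1 * (\<mu> s - \<mu> r)"
    by (simp add: gauge_def s_def r_def algebra_simps)
  then have "\<bar>gauge x1 x2 - gauge u1 u2 - (x1 - u1) * \<mu> s\<bar> = u1 * \<bar>\<mu> s - \<mu> r\<bar>"
    using pos by (simp add: abs_mult)
  also have "\<dots> \<le> (N * M) * (L * (c / M))"
  proof (intro mult_mono)
    have "L * \<bar>s - r\<bar> \<le> L * (c / M)" using close L unfolding s_def r_def by (intro mult_left_mono) auto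
    then show "\<bar>\<mu> s - \<mu> r\<bar> \<le> L * (c / M)" using lipschitz[OF J] by linarith
  qed (use close pos in auto)
  also have "\<dots> = N * L * c" using close by simp
  finally show "\<bar>gauge x1 x2 - gauge u1 u2 - (x1 - u1) * \<mu> (x2 / x1)\<bar> \<le> N * L * c" by (simp add: s_def)
  assume ne: "x1 \<noteq> u1"
  have "(x1 - u1) * tang ((x2 - u2) / (x1 - u1)) s = (x1 - u1) * \<mu> s + \<mu>' s * ((x2 - u2) - s * (x1 - u1))"
  proof -
    have "D * (m + m' * (E / D - s)) = D * m + m' * (E - s * D)" if "D \<noteq> 0" for D E m m' :: real
      using that by (simp add: field_simps)
    then show ?thesis unfolding tang_def using ne by simp
  qed
  also have "(x2 - u2) - s * (x1 - u1) = u1 * (s - r)"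
    using pos by (simp add: s_def r_def right_diff_distrib)
  finally have "gauge x1 x2 - gauge u1 u2 - (x1 - u1) * tang ((x2 - u2) / (x1 - u1)) s
      = gauge x1 x2 - gauge u1 u2 - ((x1 - u1) * \<mu> s + \<mu>' s * (u1 * (s - r)))" by simp
  also have "\<dots> = - u1 * (\<mu> r - tang r s)"
    by (simp add: gauge_def tang_def algebra_simps flip: s_def r_def)
  finally have "gauge x1 x2 - gauge u1 u2 - (x1 - u1) * tang ((x2 - u2) / (x1 - u1)) s = - u1 * (\<mu> r - tang r s)" .
  then have "\<bar>gauge x1 x2 - gauge u1 u2 - (x1 - u1) * tang ((x2 - u2) / (x1 - u1)) s\<bar> = u1 * \<bar>\<mu> r - tang r s\<bar>"
    using pos by (simp add: abs_mult)
  also have "\<dots> \<le> (N * M) * (Lam * (c / M)\<^sup>2)"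
  proof (intro mult_mono)
    have "(r - s)\<^sup>2 \<le> (c / M)\<^sup>2"
      using close by (intro power2_le_iff_abs_le[THEN iffD2]) (auto simp: s_def r_def abs_minus_commute)
    then show "\<bar>\<mu> r - tang r s\<bar> \<le> Lam * (c / M)\<^sup>2"
      using tang_error[OF J] lam by (meson mult_left_mono less_imp_le order_trans)
  qed (use close pos in auto)
  also have "\<dots> = N * Lam * c\<^sup>2 / M" using close by (simp add: power2_eq_square)
  finally show "\<bar>gauge x1 x2 - gauge u1 u2 - (x1 - u1) * tang ((x2 - u2) / (x1 - u1)) (x2 / x1)\<bar>
           \<le> N * Lam * c\<^sup>2 / M" by (simp add: s_def)
qed

text \<open>The excess \<kappa> allowed at scale \<open>x1\<close> shrinks to at most \<kappa> / 2
  when rescaled to \<open>p1\<close> \<le> \<open>x1 / 2\<close>. The other half of \<kappa> pays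
  for the deviation of (p1, p2) from the ray of x.\<close>

lemma in_sector_diff:
  fixes x1 x2 p1 p2 :: real
  assumes x: "in_sector x1 x2" and p: "1 \<le> p1" "2 * p1 \<le> x1" "\<bar>p2 - x2 / x1 * p1\<bar> \<le> \<kappa> / 2"
  shows "in_sector p1 p2"
proof -
  have x1: "x1 \<ge> 1" using x by (simp add: in_sector_def)
  have "p1 / x1 \<le> 1 / 2" using p x1 by (simp add: field_simps)
  then have k: "\<kappa> * (p1 / x1) \<le> \<kappa> / 2" using kappa mult_left_mono[of "p1 / x1" "1 / 2" \<kappa>] by simp
  have "(\<rho>0 * x1 - \<kappa>) * (p1 / x1) \<le> x2 * (p1 / x1)" "x2 * (p1 / x1) \<le> (\<rho>1 * x1 + \<kappa>) * (p1 / x1)"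
    using x x1 p by (intro mult_right_mono; simp add: in_sector_def)+
  moreover have "(\<rho>0 * x1 - \<kappa>) * (p1 / x1) = \<rho>0 * p1 - \<kappa> * (p1 / x1)"
    "(\<rho>1 * x1 + \<kappa>) * (p1 / x1) = \<rho>1 * p1 + \<kappa> * (p1 / x1)" "x2 * (p1 / x1) = x2 / x1 * p1"
    using x1 by (simp_all add: field_simps)
  ultimately have "\<rho>0 * p1 - \<kappa> * (p1 / x1) \<le> x2 / x1 * p1" "x2 / x1 * p1 \<le> \<rho>1 * p1 + \<kappa> * (p1 / x1)"
    by simp_all
  then show ?thesis using p k unfolding in_sector_def by linarith
qed

section \<open>Two solutions in a common cell\<close>

context
  fixes c N \<eta> \<omega> M :: real and x1 x2 y1 y2 u1 u2 v1 v2 :: real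
  assumes params: "c > 0" "\<eta> > 0" "M \<ge> 1" "\<omega> \<ge> 1" "N = \<omega> * \<Gamma>" "c * N \<le> \<kappa> / 2" "2 * \<eta> + 2 * N * L * c \<le> b / 2"
    and xy: "near_equal (\<eta> / M) x1 x2 y1 y2" and uv: "near_equal (\<eta> / M) u1 u2 v1 v2"
    and size: "M \<le> x1" "u1 \<le> \<omega> * M"
    and slopes: "\<bar>x2 / x1 - u2 / u1\<bar> \<le> c / M" "\<bar>y2 / y1 - v2 / v1\<bar> \<le> c / M"
begin

lemma size_le: "u1 \<le> N * M" "v1 \<le> N * M" "\<eta> / M \<le> \<eta>" "x1 > 0" "y1 > 0" "u1 > 0" "v1 > 0"
proof -
  show pos: "x1 > 0" "y1 > 0" "u1 > 0" "v1 > 0" using xy uv by (auto simp: near_equal_def in_sector_def)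
  have "u1 \<le> \<omega> * M * \<Gamma>" using size pos \<Gamma> params by (intro order_trans[OF size(2)]) auto
  then show "u1 \<le> N * M" using params by (simp add: mult_ac)
  have "v1 \<le> \<Gamma> * u1" using uv by (simp add: near_equal_def)
  also have "\<dots> \<le> \<Gamma> * (\<omega> * M)" using size \<Gamma> by (intro mult_left_mono) auto
  finally show "v1 \<le> N * M" using params by (simp add: mult_ac)
  show "\<eta> / M \<le> \<eta>" using params by (simp add: field_simps)
qed

text \<open>To leading order, the increments of g along the nearly common rays must agree. The bound
  b / 2 is small enough, because \<mu> \<ge> b, to control an integer increment
  \<open>y1 - v1\<close> in terms of \<open>x1 - u1\<close>.\<close>

lemma radial_diff: "\<bar>(x1 - u1) * \<mu> (x2 / x1) - (y1 - v1) * \<mu> (y2 / y1)\<bar> \<le> b / 2"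
proof -
  have "\<bar>gauge x1 x2 - gauge u1 u2 - (x1 - u1) * \<mu> (x2 / x1)\<bar> \<le> N * L * c"
    using xy uv slopes size_le params by (intro gauge_diff[where M = M]) (auto simp: near_equal_def)
  moreover have "\<bar>gauge y1 y2 - gauge v1 v2 - (y1 - v1) * \<mu> (y2 / y1)\<bar> \<le> N * L * c"
    using xy uv slopes size_le params by (intro gauge_diff[where M = M]) (auto simp: near_equal_def)
  moreover have "\<bar>gauge x1 x2 - gauge y1 y2\<bar> \<le> \<eta>" "\<bar>gauge u1 u2 - gauge v1 v2\<bar> \<le> \<eta>"
    using xy uv size_le unfolding near_equal_def by linarith+
  ultimately have "\<bar>(x1 - u1) * \<mu> (x2 / x1) - (y1 - v1) * \<mu> (y2 / y1)\<bar> \<le> 2 * \<eta> + 2 * (N * L * c)"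
    using abs_diff_chain by blast
  then show ?thesis using params(7) by (simp add: mult_ac)
qed

lemma deviations: "\<bar>(x2 - u2) - x2 / x1 * (x1 - u1)\<bar> \<le> c * N" "\<bar>(y2 - v2) - y2 / y1 * (y1 - v1)\<bar> \<le> c * N"
  using size_le slopes params by (intro slope_deviation[where M = M]; simp)+

lemma slope_range: "x2 / x1 \<in> {lo..hi}" "y2 / y1 \<in> {lo..hi}"
  using xy unfolding near_equal_def by (blast intro: slope_in_range)+

text \<open>Every remaining coordinate difference is an integer of absolute value at most 1/2.
  Consequently a solution within a cell is determined by its first coordinate.\<close>

lemma close_points_eq:
  assumes int: "x2 - u2 \<in> \<int>" "y1 - v1 \<in> \<int>" "y2 - v2 \<in> \<int>" and "x1 = u1"
  shows "x2 = u2" "y1 = v1" "y2 = v2"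
proof -
  have small: "z = 0" if "z \<in> \<int>" "\<bar>z\<bar> \<le> 1 / 2" for z :: real
    using that by (elim Ints_cases) auto
  have cN: "c * N \<le> 1 / 2" using params kappa by linarith
  show "x2 = u2" using small[OF int(1)] deviations(1) assms(4) cN by simp
  have "\<bar>y1 - v1\<bar> * b \<le> \<bar>y1 - v1\<bar> * \<mu> (y2 / y1)"
    using bounds slope_range by (intro mult_left_mono) auto
  also have "\<dots> = \<bar>(y1 - v1) * \<mu> (y2 / y1)\<bar>"
    using bounds(1)[OF slope_range(2)] b by (simp add: abs_mult)
  also have "\<dots> \<le> 1 / 2 * b" using radial_diff assms(4) by simp
  finally have "\<bar>y1 - v1\<bar> \<le> 1 / 2" using b by simp
  then show v: "y1 = v1" using small[OF int(2)] by simp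
  show "y2 = v2" using small[OF int(3)] deviations(2) v cN by simp
qed

text \<open>Linearizing at the slopes s, t of x, y compares the tangent forms of the two difference
  vectors up to 3 \<eta> / M. The slopes of the differences are within O(1 / p1) and O(1 / q1) of s
  and t, so passing from the tangent forms to g itself costs only O(1 / p1). This is why the
  tolerance \<open>\<eta> / p1\<close> at the new scale \<open>p1\<close> is the natural
  one.\<close>

lemma difference_near_equal:
  fixes K :: real
  assumes int: "y1 - v1 \<in> \<int>" and p1: "1 \<le> x1 - u1" "K * (x1 - u1) \<le> M"
    and K: "K \<ge> 8" "K \<ge> 2 * \<Gamma>\<^sup>2"
    and small: "N * Lam * c\<^sup>2 \<le> \<eta> / 2" "Lam * (1 + \<Gamma>) * (c * N)\<^sup>2 \<le> \<eta> / 2"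
  defines "p1 \<equiv> x1 - u1" and "p2 \<equiv> x2 - u2" and "q1 \<equiv> y1 - v1" and "q2 \<equiv> y2 - v2"
  shows "near_equal (\<eta> / p1) p1 p2 q1 q2"
    and "\<bar>x2 / x1 - p2 / p1\<bar> \<le> c * N / p1" and "\<bar>y2 / y1 - q2 / q1\<bar> \<le> c * N / q1"
    and "\<bar>p1 * tang (p2 / p1) (x2 / x1) - q1 * tang (q2 / q1) (y2 / y1)\<bar> \<le> 3 * \<eta> / M"
proof -
  define s where "s = x2 / x1"
  define t where "t = y2 / y1"
  have J: "s \<in> {lo..hi}" "t \<in> {lo..hi}" using slope_range by (auto simp: s_def t_def)
  have bB: "b \<le> B" using bounds[OF J(1)] by linarith
  have p: "1 \<le> p1" "K * p1 \<le> M" using assms by auto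
  have rd: "\<bar>p1 * \<mu> s - q1 * \<mu> t\<bar> \<le> b / 2" using radial_diff by (simp add: p1_def q1_def s_def t_def)
  have lower: "p1 * b \<le> p1 * \<mu> s" and upper: "p1 * \<mu> s \<le> p1 * B"
    using bounds[OF J(1)] p by (auto intro!: mult_left_mono)
  \<comment> \<open>The radial error is at most half of \<open>p1 * b\<close>, so \<open>q1\<close>
    inherits positivity from \<open>p1\<close>; integrality then gives \<open>q1\<close> \<ge>
    1.\<close>
  have "b / 2 \<le> p1 * b / 2" using p b by simp
  then have qt: "p1 * b / 2 \<le> q1 * \<mu> t" using lower rd by linarith
  have "0 < p1 * b / 2" using p b by simp
  then have "0 < q1 * \<mu> t" using qt by linarith
  then have q0: "q1 > 0" using bounds(1)[OF J(2)] b by (simp add: zero_less_mult_iff)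
  then have q: "q1 \<ge> 1" using int by (elim Ints_cases) (auto simp: q1_def)
  have ratio: "p1 \<le> 2 * B / b * q1" "q1 \<le> 2 * B / b * p1"
  proof -
    have "q1 * \<mu> t \<le> q1 * B" using bounds[OF J(2)] q by (intro mult_left_mono) auto
    then show "p1 \<le> 2 * B / b * q1" using qt b by (simp add: field_simps)
    have "q1 * b \<le> q1 * \<mu> t" using bounds[OF J(2)] q by (intro mult_left_mono) auto
    moreover have "b \<le> p1 * B" using bB b p mult_mono[of 1 p1 b B] by simp
    ultimately have "q1 * b \<le> 2 * (p1 * B)" using rd upper b by linarith
    then show "q1 \<le> 2 * B / b * p1" using b by (simp add: field_simps)
  qed
  have \<Gamma>pq: "p1 \<le> \<Gamma> * q1" "q1 \<le> \<Gamma> * p1"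
    using ratio mult_right_mono[OF \<Gamma>(2), of q1] mult_right_mono[OF \<Gamma>(2), of p1] p q by linarith+
  have dev: "\<bar>p2 - s * p1\<bar> \<le> c * N" "\<bar>q2 - t * q1\<bar> \<le> c * N"
    using deviations by (auto simp: p1_def p2_def q1_def q2_def s_def t_def)
  have dev': "\<bar>s - p2 / p1\<bar> \<le> c * N / p1" "\<bar>t - q2 / q1\<bar> \<le> c * N / q1"
  proof -
    have "\<bar>s - p2 / p1\<bar> = \<bar>(p2 - s * p1) / p1\<bar>" using p by (simp add: diff_divide_distrib abs_minus_commute)
    then show "\<bar>s - p2 / p1\<bar> \<le> c * N / p1" using dev p by (simp add: divide_right_mono)
    have "\<bar>t - q2 / q1\<bar> = \<bar>(q2 - t * q1) / q1\<bar>" using q by (simp add: diff_divide_distrib abs_minus_commute)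
    then show "\<bar>t - q2 / q1\<bar> \<le> c * N / q1" using dev q by (simp add: divide_right_mono)
  qed
  show "\<bar>x2 / x1 - p2 / p1\<bar> \<le> c * N / p1" "\<bar>y2 / y1 - q2 / q1\<bar> \<le> c * N / q1"
    using dev' by (simp_all add: s_def t_def)
  have sector: "in_sector p1 p2"
  proof (rule in_sector_diff)
    show "in_sector x1 x2" using xy by (simp add: near_equal_def)
    have "2 * p1 \<le> K * p1" using K p by (intro mult_right_mono) auto
    then show "2 * p1 \<le> x1" using p size by linarith
    show "\<bar>p2 - x2 / x1 * p1\<bar> \<le> \<kappa> / 2" using dev params by (simp add: s_def)
  qed (use p in auto)
  have sector': "in_sector q1 q2"
  proof (rule in_sector_diff)
    show "in_sector y1 y2" using xy by (simp add: near_equal_def)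
    have "2 * \<Gamma>\<^sup>2 * p1 \<le> K * p1" using K p by (intro mult_right_mono) auto
    also have "\<dots> \<le> x1" using p size by linarith
    also have "\<dots> \<le> \<Gamma> * y1" using xy by (simp add: near_equal_def)
    finally have "\<Gamma> * (2 * (\<Gamma> * p1)) \<le> \<Gamma> * y1" by (simp add: power2_eq_square mult_ac)
    then have "2 * (\<Gamma> * p1) \<le> y1" using \<Gamma> by (simp add: mult_le_cancel_left)
    then show "2 * q1 \<le> y1" using \<Gamma>pq by linarith
    show "\<bar>q2 - y2 / y1 * q1\<bar> \<le> \<kappa> / 2" using dev params by (simp add: t_def)
  qed (use q in auto)
  have tang_p: "\<bar>gauge x1 x2 - gauge u1 u2 - p1 * tang (p2 / p1) s\<bar> \<le> N * Lam * c\<^sup>2 / M"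
    unfolding p1_def p2_def s_def using xy uv slopes size_le params p
    by (intro gauge_diff(2)) (auto simp: near_equal_def p1_def)
  have tang_q: "\<bar>gauge y1 y2 - gauge v1 v2 - q1 * tang (q2 / q1) t\<bar> \<le> N * Lam * c\<^sup>2 / M"
    unfolding q1_def q2_def t_def using xy uv slopes size_le params q
    by (intro gauge_diff(2)) (auto simp: near_equal_def q1_def)
  \<comment> \<open>Two linearization errors of at most \<eta> / (2 M) and two tolerances \<eta> / M
    add up to 3 \<eta> / M.\<close>
  have "N * Lam * c\<^sup>2 / M \<le> (\<eta> / 2) / M" using small params by (intro divide_right_mono) auto
  then have "N * Lam * c\<^sup>2 / M \<le> \<eta> / M / 2" by simp
  moreover have "\<bar>gauge x1 x2 - gauge y1 y2\<bar> \<le> \<eta> / M" "\<bar>gauge u1 u2 - gauge v1 v2\<bar> \<le> \<eta> / M"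
    using xy uv by (auto simp: near_equal_def)
  ultimately have T: "\<bar>p1 * tang (p2 / p1) s - q1 * tang (q2 / q1) t\<bar> \<le> 3 * (\<eta> / M)"
    using abs_diff_chain[OF _ _ tang_p tang_q, of "\<eta> / M"] by fastforce
  then show "\<bar>p1 * tang (p2 / p1) (x2 / x1) - q1 * tang (q2 / q1) (y2 / y1)\<bar> \<le> 3 * \<eta> / M"
    by (simp add: s_def t_def)
  have err: "\<bar>z1 * tang (z2 / z1) w - gauge z1 z2\<bar> \<le> Lam * (c * N)\<^sup>2 / z1"
    if z: "in_sector z1 z2" "w \<in> {lo..hi}" "\<bar>w - z2 / z1\<bar> \<le> c * N / z1" for z1 z2 w
  proof -
    have z1: "z1 > 0" using z by (simp add: in_sector_def)
    have "\<bar>z1 * tang (z2 / z1) w - gauge z1 z2\<bar> = z1 * \<bar>\<mu> (z2 / z1) - tang (z2 / z1) w\<bar>"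
      using z1 by (simp add: gauge_def abs_mult abs_minus_commute flip: right_diff_distrib)
    also have "\<dots> \<le> z1 * (Lam * (z2 / z1 - w)\<^sup>2)"
      using z1 z slope_in_range by (intro mult_left_mono tang_error) auto
    also have "(z2 / z1 - w)\<^sup>2 \<le> (c * N / z1)\<^sup>2"
      using z(3) by (intro power2_le_iff_abs_le[THEN iffD2]) (auto simp: abs_minus_commute intro: order_trans[OF abs_ge_zero])
    then have "z1 * (Lam * (z2 / z1 - w)\<^sup>2) \<le> z1 * (Lam * (c * N / z1)\<^sup>2)"
      using z1 lam by (intro mult_left_mono) auto
    also have "\<dots> = Lam * (c * N)\<^sup>2 / z1" using z1 by (simp add: power2_eq_square)
    finally show ?thesis .
  qed
  have "\<bar>gauge p1 p2 - gauge q1 q2\<bar> \<le> 3 * (\<eta> / M) + Lam * (c * N)\<^sup>2 / p1 + Lam * (c * N)\<^sup>2 / q1"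
    using err[OF sector J(1) dev'(1)] err[OF sector' J(2) dev'(2)] T by linarith
  also have "Lam * (c * N)\<^sup>2 / q1 \<le> \<Gamma> * (Lam * (c * N)\<^sup>2) / p1"
  proof -
    have "Lam * (c * N)\<^sup>2 * p1 \<le> Lam * (c * N)\<^sup>2 * (\<Gamma> * q1)"
      using lam \<Gamma>pq by (intro mult_left_mono) auto
    then show ?thesis using p q by (simp add: field_simps)
  qed
  \<comment> \<open>With \<open>K\<close> \<ge> 8 this part takes at most 3/8 of the allowed
    \<open>\<eta> / p1\<close>, and the two quadratic errors take at most 1/2 of it by the choice of
    \<open>c\<close>.\<close>
  also have "3 * (\<eta> / M) \<le> 3 * (\<eta> / (8 * p1))"
  proof -
    have "8 * p1 \<le> K * p1" using K p by (intro mult_right_mono) auto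
    then have "8 * p1 \<le> M" using p by linarith
    then show ?thesis using p params by (intro mult_left_mono divide_left_mono) auto
  qed
  also have "3 * (\<eta> / (8 * p1)) + Lam * (c * N)\<^sup>2 / p1 + \<Gamma> * (Lam * (c * N)\<^sup>2) / p1
      = (3 / 8 * \<eta> + Lam * (1 + \<Gamma>) * (c * N)\<^sup>2) / p1"
    using p by (simp add: field_simps)
  also have "\<dots> \<le> \<eta> / p1" using small params p by (intro divide_right_mono) auto
  finally have "\<bar>gauge p1 p2 - gauge q1 q2\<bar> \<le> \<eta> / p1" by simp
  then show "near_equal (\<eta> / p1) p1 p2 q1 q2"
    using sector sector' \<Gamma>pq by (simp add: near_equal_def)
qed

end

end

section \<open>Descent to smaller scales\<close>

lemma finite_dyadic_indices: "K \<ge> 1 \<Longrightarrow> finite {i::nat. 2 ^ i * K \<le> (M::real)}"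
proof (rule finite_subset)
  assume K: "K \<ge> 1"
  show "{i. 2 ^ i * K \<le> M} \<subseteq> {..nat \<lceil>M\<rceil>}"
  proof
    fix i assume "i \<in> {i. 2 ^ i * K \<le> M}"
    then have "2 ^ i * K \<le> M" by simp
    moreover have "(2::real) ^ i * 1 \<le> 2 ^ i * K" using K by (intro mult_left_mono) auto
    moreover have "real i < 2 ^ i" by (rule of_nat_less_two_power)
    ultimately have "real i \<le> M" by linarith
    then show "i \<in> {..nat \<lceil>M\<rceil>}" by simp linarith
  qed
qed auto

context curved_arc
begin

lemma finite_shell: "finite (shell \<eta> i)"
proof -
  define X where "X = (\<bar>\<rho>0\<bar> + \<bar>\<rho>1\<bar> + 1) * (\<Gamma> * 2 ^ Suc i) + 1"
  have box: "z \<in> {-\<lceil>X\<rceil>..\<lceil>X\<rceil>}" if "\<bar>real_of_int z\<bar> \<le> X" for z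
    using that by (simp add: abs_le_iff) linarith
  have X1: "x \<le> X" if x: "x \<le> \<Gamma> * 2 ^ Suc i" for x
  proof -
    have "1 * (\<Gamma> * 2 ^ Suc i) \<le> (\<bar>\<rho>0\<bar> + \<bar>\<rho>1\<bar> + 1) * (\<Gamma> * 2 ^ Suc i)"
      using \<Gamma> by (intro mult_right_mono) auto
    then show "x \<le> X" using x unfolding X_def by linarith
  qed
  have X2: "\<bar>y\<bar> \<le> X" if s: "in_sector x y" "x \<le> \<Gamma> * 2 ^ Suc i" for x y
  proof -
    have x: "x \<ge> 1" using s by (simp add: in_sector_def)
    have "\<bar>\<rho>0 * x\<bar> \<le> \<bar>\<rho>0\<bar> * (\<Gamma> * 2 ^ Suc i)" "\<bar>\<rho>1 * x\<bar> \<le> \<bar>\<rho>1\<bar> * (\<Gamma> * 2 ^ Suc i)"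
      using s x by (auto simp: abs_mult simp del: power_Suc intro!: mult_left_mono)
    moreover have "\<bar>y\<bar> \<le> \<bar>\<rho>0 * x\<bar> + \<bar>\<rho>1 * x\<bar> + 1" using s kappa unfolding in_sector_def by linarith
    moreover have "0 \<le> \<Gamma> * 2 ^ Suc i" using \<Gamma> by simp
    ultimately show ?thesis unfolding X_def by (simp add: distrib_right)
  qed
  have "shell \<eta> i \<subseteq> {-\<lceil>X\<rceil>..\<lceil>X\<rceil>} \<times> {-\<lceil>X\<rceil>..\<lceil>X\<rceil>} \<times> {-\<lceil>X\<rceil>..\<lceil>X\<rceil>} \<times> {-\<lceil>X\<rceil>..\<lceil>X\<rceil>}"
  proof
    fix z assume "z \<in> shell \<eta> i"
    then obtain a b c d where z: "z = (a, b, c, d)" and a: "real_of_int a < 2 ^ Suc i"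
      and near: "near_equal (\<eta> / of_int a) (of_int a) (of_int b) (of_int c) (of_int d)"
      by (auto simp: shell_def)
    have s: "in_sector (of_int a) (of_int b)" "in_sector (of_int c) (of_int d)" "real_of_int c \<le> \<Gamma> * of_int a"
      using near by (auto simp: near_equal_def)
    have "(1::real) * 2 ^ Suc i \<le> \<Gamma> * 2 ^ Suc i" using \<Gamma> by (intro mult_right_mono) auto
    then have a': "real_of_int a \<le> \<Gamma> * 2 ^ Suc i" using a by linarith
    have "\<Gamma> * real_of_int a \<le> \<Gamma> * 2 ^ Suc i" using a \<Gamma> by (intro mult_left_mono) auto
    then have c': "real_of_int c \<le> \<Gamma> * 2 ^ Suc i" using s by linarith
    have "real_of_int a \<ge> 1" "real_of_int c \<ge> 1" using s by (auto simp: in_sector_def)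
    then show "z \<in> {-\<lceil>X\<rceil>..\<lceil>X\<rceil>} \<times> {-\<lceil>X\<rceil>..\<lceil>X\<rceil>} \<times> {-\<lceil>X\<rceil>..\<lceil>X\<rceil>} \<times> {-\<lceil>X\<rceil>..\<lceil>X\<rceil>}"
      using X1[of "of_int a"] X1[of "of_int c"] X2[OF s(1) a'] X2[OF s(2) c'] a' c' unfolding z
      by (intro SigmaI box) auto
  qed
  then show ?thesis by (rule finite_subset) auto
qed

lemma card_cells_total_le:
  assumes "c > 0" "M \<ge> 1" and Z: "\<And>z. z \<in> Z \<Longrightarrow> \<exists>s\<in>{lo..hi}. \<exists>t\<in>{lo..hi}. z = (\<lfloor>s * M / c\<rfloor>, \<lfloor>t * M / c\<rfloor>)"
  shows "finite Z" "real (card Z) \<le> ((hi - lo) / c + 2)\<^sup>2 * M\<^sup>2"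
proof -
  let ?I = "{\<lfloor>lo * M / c\<rfloor>..\<lfloor>hi * M / c\<rfloor>}"
  have sub: "Z \<subseteq> ?I \<times> ?I"
    using Z assms(1,2) by (force intro!: floor_mono divide_right_mono mult_right_mono)
  then show "finite Z" by (rule finite_subset) auto
  have "card Z \<le> card (?I \<times> ?I)" using sub by (intro card_mono) auto
  then have Zc: "real (card Z) \<le> (real (card ?I))\<^sup>2" by (simp add: power2_eq_square flip: of_nat_mult)
  show "real (card Z) \<le> ((hi - lo) / c + 2)\<^sup>2 * M\<^sup>2"
  proof (cases "?I = {}")
    case True
    then have "Z = {}" using sub by simp
    then show ?thesis by simp
  next
    case False
    then have le: "\<lfloor>lo * M / c\<rfloor> \<le> \<lfloor>hi * M / c\<rfloor>" by simp
    have fl: "real_of_int (\<lfloor>v\<rfloor> - \<lfloor>u\<rfloor> + 1) \<le> v - u + 2" for u v :: real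
      using floor_correct[of u] floor_correct[of v] by simp linarith
    have "real (card ?I) = real_of_int (\<lfloor>hi * M / c\<rfloor> - \<lfloor>lo * M / c\<rfloor> + 1)" using le by simp
    also have "\<dots> \<le> hi * M / c - lo * M / c + 2" by (rule fl)
    also have "\<dots> \<le> ((hi - lo) / c + 2) * M" using assms(2) by (simp add: algebra_simps diff_divide_distrib)
    finally have "(real (card ?I))\<^sup>2 \<le> (((hi - lo) / c + 2) * M)\<^sup>2" by (intro power_mono) auto
    then show ?thesis unfolding power_mult_distrib by (rule order_trans[OF Zc])
  qed
qed

text \<open>Cells with at most 2 \<omega> K solutions contribute O(K M^2) together. A fuller cell
  contains two solutions whose first coordinates differ by some p1 \<le> M / K and are so close that
  the cell has at most 2 \<omega> M / p1 solutions; it is charged to that difference. Each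
  difference is charged by O((M / p1) ln(M / p1) + M / p1) cells. \<open>C\<close> is independent of
  \<open>K\<close>, which is what later lets \<open>K\<close> be chosen to make the recursion
  contract.\<close>

lemma descent:
  assumes \<omega>: "\<omega> \<ge> 2"
  shows "\<exists>\<eta>>0. \<exists>C>0. \<exists>K0\<ge>1. \<forall>K\<ge>K0. \<forall>M\<ge>1. \<forall>\<theta>1 \<theta>2 W. finite W \<longrightarrow>
    (\<forall>(m1, m2, m3, m4)\<in>W. near_equal (\<eta> / M) (of_int m1 + \<theta>1) (of_int m2 + \<theta>2) (of_int m3 + \<theta>1) (of_int m4 + \<theta>2)
        \<and> M \<le> of_int m1 + \<theta>1 \<and> of_int m1 + \<theta>1 \<le> \<omega> * M) \<longrightarrow>
    real (card W) \<le> C * K * M\<^sup>2 +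
      C * (\<Sum>i | 2 ^ i * K \<le> M. (M / 2 ^ i)\<^sup>2 * (1 + ln (M / 2 ^ i)) * real (card (shell \<eta> i)))"
proof -
  define N where "N = \<omega> * \<Gamma>"
  define \<eta> where "\<eta> = b / 8"
  have N: "N > 0" and \<eta>: "\<eta> > 0" using \<omega> \<Gamma> b by (auto simp: N_def \<eta>_def)
  \<comment> \<open>In order, the entries give \<open>c\<^sup>2\<close> \<le> c, the slope deviation
    \<open>c * N\<close> \<le> \<kappa> / 2, the bound b / 2 in \<open>radial_diff\<close> (with 2
    \<eta> = b / 4), and the two smallness conditions of
    \<open>difference_near_equal\<close>.\<close>
  define c where "c = min (min 1 (\<kappa> / (2 * N))) (min (b / (8 * N * L)) (min (\<eta> / (2 * N * Lam)) (\<eta> / (2 * Lam * (1 + \<Gamma>) * N\<^sup>2))))"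
  have c: "c > 0" using N \<eta> b kappa L lam \<Gamma> by (simp add: c_def)
  have cb: "c \<le> 1" "c \<le> \<kappa> / (2 * N)" "c \<le> b / (8 * N * L)" "c \<le> \<eta> / (2 * N * Lam)" "c \<le> \<eta> / (2 * Lam * (1 + \<Gamma>) * N\<^sup>2)"
    unfolding c_def by linarith+
  have c2: "c\<^sup>2 \<le> c" using c cb by (simp add: power2_eq_square mult_left_le)
  have par: "c * N \<le> \<kappa> / 2" "2 * \<eta> + 2 * N * L * c \<le> b / 2"
    using cb N L b by (simp_all add: \<eta>_def field_simps)
  have small1: "N * Lam * c\<^sup>2 \<le> \<eta> / 2"
  proof -
    have "N * Lam * c\<^sup>2 \<le> N * Lam * c" using c2 N lam by (intro mult_left_mono) auto
    also have "\<dots> \<le> \<eta> / 2" using cb N lam by (simp add: field_simps)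
    finally show ?thesis .
  qed
  have small2: "Lam * (1 + \<Gamma>) * (c * N)\<^sup>2 \<le> \<eta> / 2"
  proof -
    have "Lam * (1 + \<Gamma>) * (c * N)\<^sup>2 = Lam * (1 + \<Gamma>) * N\<^sup>2 * c\<^sup>2" by (simp add: power_mult_distrib)
    also have "\<dots> \<le> Lam * (1 + \<Gamma>) * N\<^sup>2 * c" using c2 lam \<Gamma> by (intro mult_left_mono) auto
    also have "\<dots> \<le> \<eta> / 2"
    proof -
      have "2 * Lam * (1 + \<Gamma>) * N\<^sup>2 > 0" using lam \<Gamma> N by (intro mult_pos_pos) auto
      then show ?thesis using cb(5) by (simp add: pos_le_divide_eq algebra_simps)
    qed
    finally show ?thesis .
  qed
  obtain C1 where C1: "C1 > 0" and cells: "\<And>q q' M r r' H. q > 0 \<Longrightarrow> q' > 0 \<Longrightarrow> q \<le> M \<Longrightarrow> q \<le> \<Gamma> * q' \<Longrightarrow> q' \<le> \<Gamma> * q \<Longrightarrow>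
           \<forall>z\<in>H. \<exists>s\<in>{lo..hi}. \<exists>t\<in>{lo..hi}. z = (\<lfloor>s * M / c\<rfloor>, \<lfloor>t * M / c\<rfloor>) \<and>
               \<bar>s - r\<bar> \<le> c * N / q \<and> \<bar>t - r'\<bar> \<le> c * N / q' \<and> \<bar>q * tang r s - q' * tang r' t\<bar> \<le> 3 * \<eta> / M \<Longrightarrow>
           real (card H) \<le> C1 * (M / q * (1 + ln (M / q)))"
    using card_cells_le[of \<Gamma> c "c * N" "3 * \<eta>"] \<Gamma> c N \<eta> by (auto simp: mult_pos_pos)
  define C2 where "C2 = ((hi - lo) / c + 2)\<^sup>2"
  define C where "C = 1 + 2 * \<omega> * C2 + 2 * \<omega> * C1"
  have C: "C > 0" "2 * \<omega> * C2 \<le> C" "2 * \<omega> * C1 \<le> C" using C1 \<omega> by (auto simp: C_def C2_def intro!: add_pos_nonneg)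
  define K0 where "K0 = max 8 (2 * \<Gamma>\<^sup>2)"
  show ?thesis
  proof (rule exI[of _ \<eta>], intro conjI \<eta>, rule exI[of _ C], intro conjI C(1), rule exI[of _ K0], intro conjI allI impI)
    show "1 \<le> K0" by (simp add: K0_def)
    fix K M \<theta>1 \<theta>2 :: real and W :: "(int \<times> int \<times> int \<times> int) set"
    assume K: "K0 \<le> K" and M: "1 \<le> M" and fin: "finite W"
      and W: "\<forall>(m1, m2, m3, m4)\<in>W. near_equal (\<eta> / M) (of_int m1 + \<theta>1) (of_int m2 + \<theta>2) (of_int m3 + \<theta>1) (of_int m4 + \<theta>2)
        \<and> M \<le> of_int m1 + \<theta>1 \<and> of_int m1 + \<theta>1 \<le> \<omega> * M"
    have K': "K \<ge> 8" "K \<ge> 2 * \<Gamma>\<^sup>2" using K by (auto simp: K0_def)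
    define X1 X2 Y1 Y2 :: "int \<times> int \<times> int \<times> int \<Rightarrow> real"
      where "X1 = (\<lambda>(m1, m2, m3, m4). of_int m1 + \<theta>1)" and "X2 = (\<lambda>(m1, m2, m3, m4). of_int m2 + \<theta>2)"
        and "Y1 = (\<lambda>(m1, m2, m3, m4). of_int m3 + \<theta>1)" and "Y2 = (\<lambda>(m1, m2, m3, m4). of_int m4 + \<theta>2)"
    have W': "near_equal (\<eta> / M) (X1 w) (X2 w) (Y1 w) (Y2 w)" "M \<le> X1 w" "X1 w \<le> \<omega> * M" if "w \<in> W" for w
      using W that by (auto simp: X1_def X2_def Y1_def Y2_def)
    have diff_int: "X1 w - X1 w' \<in> \<int>" "X2 w - X2 w' \<in> \<int>" "Y1 w - Y1 w' \<in> \<int>" "Y2 w - Y2 w' \<in> \<int>" for w w'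
      by (auto simp: X1_def X2_def Y1_def Y2_def split: prod.splits)
    have ext: "w = w'" if "X1 w = X1 w'" "X2 w = X2 w'" "Y1 w = Y1 w'" "Y2 w = Y2 w'" for w w'
      using that by (auto simp: X1_def X2_def Y1_def Y2_def split: prod.splits)
    define cell where "cell = (\<lambda>w. (\<lfloor>X2 w / X1 w * M / c\<rfloor>, \<lfloor>Y2 w / Y1 w * M / c\<rfloor>))"
    define fib where "fib = (\<lambda>z. {w \<in> W. cell w = z})"
    have finfib: "finite (fib z)" for z using fin by (simp add: fib_def)
    have slopeJ: "X2 w / X1 w \<in> {lo..hi}" "Y2 w / Y1 w \<in> {lo..hi}" if "w \<in> W" for w
      using W'(1)[OF that] unfolding near_equal_def by (blast intro: slope_in_range)+
    have slopes: "\<bar>X2 w / X1 w - X2 w' / X1 w'\<bar> \<le> c / M" "\<bar>Y2 w / Y1 w - Y2 w' / Y1 w'\<bar> \<le> c / M"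
      if "cell w = cell w'" for w w'
      using that c M unfolding cell_def by (auto intro!: floor_eq_imp_close)
    have \<omega>1: "\<omega> \<ge> 1" using \<omega> by simp
    have inj: "w = w'" if "w \<in> fib z" "w' \<in> fib z" "X1 w = X1 w'" for z w w'
    proof -
      have ww: "w \<in> W" "w' \<in> W" "cell w = cell w'" using that by (auto simp: fib_def)
      have "X2 w = X2 w'" "Y1 w = Y1 w'" "Y2 w = Y2 w'"
        using close_points_eq[OF c \<eta> M \<omega>1 N_def par W'(1)[OF ww(1)] W'(1)[OF ww(2)] W'(2)[OF ww(1)] W'(3)[OF ww(2)]
            slopes[OF ww(3)] diff_int(2) diff_int(3) diff_int(4) that(3)] by auto
      then show ?thesis using that(3) ext by blast
    qed
    define Z where "Z = cell ` W"
    \<comment> \<open>The threshold is calibrated to the close pair found below: a gap p1 with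
      \<open>card (fib z) * p1 < 2 * \<omega> * M\<close> then satisfies \<open>K * p1\<close> \<le>
      M.\<close>
    define Big where "Big = {z \<in> Z. real (card (fib z)) > 2 * \<omega> * K}"
    have Zcells: "\<exists>s\<in>{lo..hi}. \<exists>t\<in>{lo..hi}. z = (\<lfloor>s * M / c\<rfloor>, \<lfloor>t * M / c\<rfloor>)" if "z \<in> Z" for z
      using that slopeJ unfolding Z_def cell_def by blast
    note Zcard = card_cells_total_le[OF c M Zcells, of Z, simplified]
    define I where "I = {i::nat. 2 ^ i * K \<le> M}"
    have finI: "finite I" unfolding I_def using K' by (intro finite_dyadic_indices) auto
    define S where "S = Sigma I (shell \<eta>)"
    have finS: "finite S" using finI finite_shell by (simp add: S_def)
    \<comment> \<open>The most solutions that a cell charged to the difference \<open>P\<close> can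
      have.\<close>
    define wt where "wt = (\<lambda>(i::nat, P::int \<times> int \<times> int \<times> int). 2 * \<omega> * M / real_of_int (fst P))"
    \<comment> \<open>The compatibility of a cell with a difference, in the form that
      \<open>card_cells_le\<close> counts.\<close>
    define visits :: "int \<times> int \<Rightarrow> nat \<times> int \<times> int \<times> int \<times> int \<Rightarrow> bool" where
      "visits = (\<lambda>z (i, (p1, p2, q1, q2)). \<exists>s\<in>{lo..hi}. \<exists>t\<in>{lo..hi}. z = (\<lfloor>s * M / c\<rfloor>, \<lfloor>t * M / c\<rfloor>) \<and>
               \<bar>s - of_int p2 / of_int p1\<bar> \<le> c * N / of_int p1 \<and> \<bar>t - of_int q2 / of_int q1\<bar> \<le> c * N / of_int q1 \<and>
               \<bar>of_int p1 * tang (of_int p2 / of_int p1) s - of_int q1 * tang (of_int q2 / of_int q1) t\<bar> \<le> 3 * \<eta> / M)"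
    have step: "\<exists>p. p \<in> S \<and> real (card (fib z)) \<le> wt p \<and>
        visits z p"
      if z: "z \<in> Big" for z
    proof -
      \<comment> \<open>Distinct solutions of a cell have distinct first coordinates, so the
        pigeonhole may be applied to these real numbers alone.\<close>
      have inj1: "inj_on X1 (fib z)" by (rule inj_onI) (rule inj)
      then have cX: "card (X1 ` fib z) = card (fib z)" by (rule card_image)
      have big: "real (card (fib z)) > 2 * \<omega> * K" using z by (simp add: Big_def)
      have "2 * \<omega> * K \<ge> 2 * 2 * 8" using \<omega> K' by (intro mult_mono) auto
      then have "card (X1 ` fib z) \<ge> 3" using big cX by linarith
      moreover have "X1 ` fib z \<subseteq> {M..M + \<omega> * M}"
        using W' M by (fastforce simp: fib_def)
      ultimately obtain x y where xy: "x \<in> X1 ` fib z" "y \<in> X1 ` fib z" "x < y" "real (card (fib z)) * (y - x) < 2 * (\<omega> * M)"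
        using exists_close_pair[of "X1 ` fib z" M "\<omega> * M"] finfib cX M \<omega> by auto
      then obtain w w' where w: "w \<in> fib z" "w' \<in> fib z" "X1 w' < X1 w"
        "real (card (fib z)) * (X1 w - X1 w') < 2 * (\<omega> * M)" by auto
      have ww: "w \<in> W" "w' \<in> W" "cell w = cell w'" "z = cell w" using w by (auto simp: fib_def)
      obtain p1 p2 q1 q2 :: int where p: "X1 w - X1 w' = of_int p1" "X2 w - X2 w' = of_int p2"
        "Y1 w - Y1 w' = of_int q1" "Y2 w - Y2 w' = of_int q2"
        using diff_int[of w w'] by (auto elim!: Ints_cases)
      have p1: "p1 \<ge> 1" using p(1) w(3) by linarith
      have "2 * \<omega> * K * of_int p1 \<le> real (card (fib z)) * of_int p1" using big p1 by (intro mult_right_mono) auto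
      also have "\<dots> < 2 * (\<omega> * M)" using w(4) p(1) by simp
      finally have "(2 * \<omega>) * (K * of_int p1) < (2 * \<omega>) * M" by (simp add: mult_ac)
      then have Kp: "K * of_int p1 \<le> M" using \<omega> by (simp add: mult_less_cancel_left)
      have int: "1 \<le> X1 w - X1 w'" "K * (X1 w - X1 w') \<le> M" using p(1) p1 Kp by auto
      note D = difference_near_equal[OF c \<eta> M \<omega>1 N_def par W'(1)[OF ww(1)] W'(1)[OF ww(2)] W'(2)[OF ww(1)] W'(3)[OF ww(2)]
            slopes[OF ww(3)] diff_int(3) int K' small1 small2, unfolded p]
      obtain i where i: "2 ^ i \<le> real_of_int p1" "real_of_int p1 < 2 ^ Suc i"
      proof -
        have "1 \<le> nat p1" using p1 by linarith
        then obtain i where "2 ^ i \<le> nat p1" "nat p1 < 2 ^ Suc i"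
          using ex_power_ivl1[of 2 "nat p1"] by auto
        then have "2 ^ i \<le> real (nat p1)" "real (nat p1) < 2 ^ Suc i"
          by (metis of_nat_le_iff of_nat_numeral of_nat_power, metis of_nat_less_iff of_nat_numeral of_nat_power)
        then show ?thesis using that p1 by simp
      qed
      have "2 ^ i * K \<le> of_int p1 * K" using i K' by (intro mult_right_mono) auto
      then have "i \<in> I" using Kp by (simp add: I_def mult.commute)
      moreover have "(p1, p2, q1, q2) \<in> shell \<eta> i" using i D(1) by (simp add: shell_def)
      ultimately have S: "(i, p1, p2, q1, q2) \<in> S" by (simp add: S_def)
      have wt: "real (card (fib z)) \<le> wt (i, p1, p2, q1, q2)"
        using w(4) p(1) p1 by (simp add: wt_def field_simps)
      show ?thesis
      proof (rule exI[of _ "(i, p1, p2, q1, q2)"], rule conjI[OF S conjI[OF wt]], unfold visits_def prod.case,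
          rule bexI[OF _ slopeJ(1)[OF ww(1)]], rule bexI[OF _ slopeJ(2)[OF ww(1)]], intro conjI D(2-4))
        show "z = (\<lfloor>X2 w / X1 w * M / c\<rfloor>, \<lfloor>Y2 w / Y1 w * M / c\<rfloor>)" by (simp only: ww(4) cell_def)
      qed
    qed
    then have "\<forall>z\<in>Big. \<exists>p. p \<in> S \<and> real (card (fib z)) \<le> wt p \<and> visits z p" by blast
    then obtain P where "\<forall>z\<in>Big. P z \<in> S \<and> real (card (fib z)) \<le> wt (P z) \<and> visits z (P z)"
      by (rule bchoice[THEN exE])
    then have P: "P z \<in> S" "real (card (fib z)) \<le> wt (P z)" "visits z (P z)" if "z \<in> Big" for z
      using that by blast+
    have finZ: "finite Z" "finite Big" using fin by (auto simp: Z_def Big_def)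
    \<comment> \<open>One factor M / p1 comes from the number of cells charged to the difference,
      the other from the weight. Replacing p1 by the lower end 2^i of its shell makes the bound
      depend on the shell only.\<close>
    have mult: "real (card {z \<in> Big. P z = p}) * wt p \<le> 2 * \<omega> * C1 * ((M / 2 ^ fst p)\<^sup>2 * (1 + ln (M / 2 ^ fst p)))"
      if p: "p \<in> S" for p
    proof -
      obtain i p1 p2 q1 q2 where pe: "p = (i, p1, p2, q1, q2)" by (metis prod_cases5)
      have sh: "i \<in> I" "(p1, p2, q1, q2) \<in> shell \<eta> i" using p by (auto simp: S_def pe)
      have ne: "near_equal (\<eta> / of_int p1) (of_int p1) (of_int p2) (of_int q1) (of_int q2)"
        and i: "2 ^ i \<le> real_of_int p1" "real_of_int p1 < 2 ^ Suc i" using sh by (auto simp: shell_def)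
      have pq: "real_of_int p1 \<ge> 1" "real_of_int q1 \<ge> 1" "of_int p1 \<le> \<Gamma> * of_int q1" "of_int q1 \<le> \<Gamma> * of_int p1"
        using ne by (auto simp: near_equal_def in_sector_def)
      have "2 ^ i * 8 \<le> 2 ^ i * K" using K' by (intro mult_left_mono) auto
      also have "\<dots> \<le> M" using sh by (simp add: I_def)
      finally have iM: "2 ^ i * 8 \<le> M" .
      have "real_of_int p1 < 2 * 2 ^ i" "(0::real) < 2 ^ i" using i by simp_all
      then have p1M: "of_int p1 \<le> M" using iM by linarith
      have "real (card {z \<in> Big. P z = p}) \<le> C1 * (M / of_int p1 * (1 + ln (M / of_int p1)))"
      proof (rule cells)
        show "\<forall>z\<in>{z \<in> Big. P z = p}. \<exists>s\<in>{lo..hi}. \<exists>t\<in>{lo..hi}. z = (\<lfloor>s * M / c\<rfloor>, \<lfloor>t * M / c\<rfloor>) \<and>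
               \<bar>s - of_int p2 / of_int p1\<bar> \<le> c * N / of_int p1 \<and> \<bar>t - of_int q2 / of_int q1\<bar> \<le> c * N / of_int q1 \<and>
               \<bar>of_int p1 * tang (of_int p2 / of_int p1) s - of_int q1 * tang (of_int q2 / of_int q1) t\<bar> \<le> 3 * \<eta> / M"
        proof
          fix z assume "z \<in> {z \<in> Big. P z = p}"
          then have "visits z p" using P(3)[of z] by blast
          then show "\<exists>s\<in>{lo..hi}. \<exists>t\<in>{lo..hi}. z = (\<lfloor>s * M / c\<rfloor>, \<lfloor>t * M / c\<rfloor>) \<and>
               \<bar>s - of_int p2 / of_int p1\<bar> \<le> c * N / of_int p1 \<and> \<bar>t - of_int q2 / of_int q1\<bar> \<le> c * N / of_int q1 \<and>
               \<bar>of_int p1 * tang (of_int p2 / of_int p1) s - of_int q1 * tang (of_int q2 / of_int q1) t\<bar> \<le> 3 * \<eta> / M"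
            unfolding visits_def pe prod.case .
        qed
      qed (use pq p1M in auto)
      then have "real (card {z \<in> Big. P z = p}) * wt p \<le> C1 * (M / of_int p1 * (1 + ln (M / of_int p1))) * (2 * \<omega> * M / of_int p1)"
        unfolding pe wt_def using pq M \<omega> by (simp only: prod.case fst_conv) (intro mult_right_mono; auto)
      also have "\<dots> = 2 * \<omega> * C1 * ((M / of_int p1)\<^sup>2 * (1 + ln (M / of_int p1)))"
        by (simp add: power2_eq_square)
      also have "\<dots> \<le> 2 * \<omega> * C1 * ((M / 2 ^ i)\<^sup>2 * (1 + ln (M / 2 ^ i)))"
      proof -
        have le: "M / of_int p1 \<le> M / 2 ^ i" using i M pq by (intro divide_left_mono) auto
        have ge: "1 \<le> M / of_int p1" using p1M pq by simp
        have "(M / of_int p1)\<^sup>2 \<le> (M / 2 ^ i)\<^sup>2" "ln (M / of_int p1) \<le> ln (M / 2 ^ i)"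
          using le ge by (auto intro!: power_mono)
        then show ?thesis using ge C1 \<omega> by (intro mult_left_mono mult_mono) auto
      qed
      finally show ?thesis by (simp add: pe)
    qed
    have "card W = (\<Sum>z\<in>Z. card (fib z))"
      using sum.image_gen[OF fin, of "\<lambda>_. 1::nat" cell] by (simp add: Z_def fib_def)
    then have "real (card W) = (\<Sum>z\<in>Z. real (card (fib z)))" by simp
    also have "\<dots> = (\<Sum>z\<in>Z - Big. real (card (fib z))) + (\<Sum>z\<in>Big. real (card (fib z)))"
      using finZ by (intro sum.subset_diff) (auto simp: Big_def)
    also have "(\<Sum>z\<in>Z - Big. real (card (fib z))) \<le> (\<Sum>z\<in>Z - Big. 2 * \<omega> * K)"
      by (intro sum_mono) (auto simp: Big_def)
    also have "\<dots> = real (card (Z - Big)) * (2 * \<omega> * K)" by simp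
    also have "\<dots> \<le> (C2 * M\<^sup>2) * (2 * \<omega> * K)"
    proof (rule mult_right_mono)
      have "card (Z - Big) \<le> card Z" using finZ by (intro card_mono) auto
      then show "real (card (Z - Big)) \<le> C2 * M\<^sup>2" using Zcard by (simp add: C2_def)
    qed (use \<omega> K' in auto)
    also have "\<dots> = (2 * \<omega> * C2) * (K * M\<^sup>2)" by (simp add: mult_ac)
    also have "\<dots> \<le> C * (K * M\<^sup>2)" using C K' by (intro mult_right_mono) auto
    also have "(\<Sum>z\<in>Big. real (card (fib z))) \<le> (\<Sum>z\<in>Big. wt (P z))" using P by (intro sum_mono) auto
    \<comment> \<open>Double counting: the full cells are grouped by the difference to which they
      are charged.\<close>
    also have "\<dots> = (\<Sum>p\<in>S. \<Sum>z\<in>{z \<in> Big. P z = p}. wt (P z))"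
      using finZ finS P(1) by (intro sum.group[symmetric]) auto
    also have "\<dots> = (\<Sum>p\<in>S. real (card {z \<in> Big. P z = p}) * wt p)" by (intro sum.cong) auto
    also have "\<dots> \<le> (\<Sum>p\<in>S. 2 * \<omega> * C1 * ((M / 2 ^ fst p)\<^sup>2 * (1 + ln (M / 2 ^ fst p))))"
      by (intro sum_mono mult)
    also have "\<dots> = (\<Sum>i\<in>I. \<Sum>P\<in>shell \<eta> i. 2 * \<omega> * C1 * ((M / 2 ^ i)\<^sup>2 * (1 + ln (M / 2 ^ i))))"
      unfolding S_def using finI finite_shell by (subst sum.Sigma) (auto intro!: sum.cong)
    also have "\<dots> = 2 * \<omega> * C1 * (\<Sum>i\<in>I. (M / 2 ^ i)\<^sup>2 * (1 + ln (M / 2 ^ i)) * real (card (shell \<eta> i)))"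
      by (simp add: sum_distrib_left mult_ac)
    also have "\<dots> \<le> C * (\<Sum>i\<in>I. (M / 2 ^ i)\<^sup>2 * (1 + ln (M / 2 ^ i)) * real (card (shell \<eta> i)))"
    proof (intro mult_right_mono C sum_nonneg mult_nonneg_nonneg)
      fix i assume "i \<in> I"
      have "(2::real) ^ i * 1 \<le> 2 ^ i * K" using K' by (intro mult_left_mono) auto
      also have "\<dots> \<le> M" using \<open>i \<in> I\<close> by (simp add: I_def)
      finally have "1 \<le> M / 2 ^ i" by simp
      then show "0 \<le> 1 + ln (M / 2 ^ i)" by simp
    qed auto
    finally show "real (card W) \<le> C * K * M\<^sup>2 +
      C * (\<Sum>i | 2 ^ i * K \<le> M. (M / 2 ^ i)\<^sup>2 * (1 + ln (M / 2 ^ i)) * real (card (shell \<eta> i)))"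
      by (simp add: I_def mult_ac)
  qed
qed

end

section \<open>Solving the recursion\<close>

lemma sum_dyadic_le:
  fixes a K M :: real
  assumes "a > 0" "K \<ge> 1" "M > 0"
  shows "(\<Sum>i | 2 ^ i * K \<le> M. (2 ^ i / M) powr a) \<le> 2 powr a / (2 powr a - 1) * K powr (- a)"
proof (cases "{i::nat. 2 ^ i * K \<le> M} = {}")
  case True
  have "2 powr a > 1" using assms by simp
  then show ?thesis unfolding True by simp
next
  case False
  define x where "x = 2 powr a"
  have x: "x > 1" using assms by (simp add: x_def)
  \<comment> \<open>A geometric progression is dominated by its largest term, here the one with
    \<open>2 ^ m / M\<close> \<le> \<open>1 / K\<close>; this yields the gain
    \<open>K powr (- a)\<close>.\<close>
  define m where "m = Max {i::nat. 2 ^ i * K \<le> M}"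
  have fin: "finite {i::nat. 2 ^ i * K \<le> M}" using assms by (intro finite_dyadic_indices) auto
  have m: "2 ^ m * K \<le> M" "{i::nat. 2 ^ i * K \<le> M} \<subseteq> {..<Suc m}"
    using Max_in[OF fin False] Max_ge[OF fin] by (auto simp: m_def less_Suc_eq_le)
  have pw: "(2 ^ i / M) powr a = x ^ i / M powr a" for i
    using assms by (simp add: powr_divide x_def powr_powr powr_realpow[symmetric] mult.commute powr_power)
  have "(\<Sum>i | 2 ^ i * K \<le> M. (2 ^ i / M) powr a) \<le> (\<Sum>i<Suc m. (2 ^ i / M) powr a)"
    using m by (intro sum_mono2) auto
  also have "\<dots> = (\<Sum>i<Suc m. x ^ i) / M powr a" by (simp only: pw sum_divide_distrib)
  also have "(\<Sum>i<Suc m. x ^ i) = (x ^ Suc m - 1) / (x - 1)" using x by (subst geometric_sum) auto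
  also have "(x ^ Suc m - 1) / (x - 1) / M powr a \<le> x ^ Suc m / (x - 1) / M powr a"
    using x by (intro divide_right_mono) auto
  also have "\<dots> = x / (x - 1) * (x ^ m / M powr a)" by simp
  also have "x ^ m / M powr a = (2 ^ m / M) powr a" by (simp only: pw)
  also have "(2 ^ m / M) powr a \<le> (1 / K) powr a"
    using m(1) assms by (intro powr_mono2) (auto simp: field_simps)
  also have "(1 / K) powr a = K powr (- a)" using assms by (simp add: powr_divide powr_minus_divide)
  finally show ?thesis using x by (simp add: x_def[symmetric] mult_left_mono divide_right_mono)
qed

text \<open>With the inductive bound inserted, the powers combine to M^(2+e) (2^i / M)^e times a
  logarithm. Half of the exponent e absorbs the logarithm, and the other half makes the dyadic sum
  converge with the saving K^(-e/2).\<close>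

lemma descent_sum_le:
  fixes e K M B :: real and n :: "nat \<Rightarrow> real"
  assumes "e > 0" "K \<ge> 1" "M > 0" "B \<ge> 0"
    and n: "\<And>i. 2 ^ i * K \<le> M \<Longrightarrow> n i \<le> B * (2 ^ i) powr (2 + e)"
  shows "(\<Sum>i | 2 ^ i * K \<le> M. (M / 2 ^ i)\<^sup>2 * (1 + ln (M / 2 ^ i)) * n i)
    \<le> (1 + 2 / e) * (2 powr (e / 2) / (2 powr (e / 2) - 1)) * B * K powr (- e / 2) * M powr (2 + e)"
proof -
  have "(\<Sum>i | 2 ^ i * K \<le> M. (M / 2 ^ i)\<^sup>2 * (1 + ln (M / 2 ^ i)) * n i)
    \<le> (\<Sum>i | 2 ^ i * K \<le> M. (1 + 2 / e) * B * M powr (2 + e) * (2 ^ i / M) powr (e / 2))"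
  proof (rule sum_mono)
    fix i assume "i \<in> {i. 2 ^ i * K \<le> M}"
    then have i: "2 ^ i * K \<le> M" by simp
    define y where "y = (2::real) ^ i"
    have y: "y > 0" by (simp add: y_def)
    have "y * 1 \<le> y * K" using assms y by (intro mult_left_mono) auto
    also have "\<dots> \<le> M" using i by (simp add: y_def)
    finally have z: "1 \<le> M / y" using y by simp
    have "ln (M / y) \<le> (M / y) powr (e / 2) / (e / 2)" using z assms by (intro ln_powr_bound) auto
    moreover have "1 \<le> (M / y) powr (e / 2)" using z assms by (intro ge_one_powr_ge_zero) auto
    ultimately have l: "1 + ln (M / y) \<le> (1 + 2 / e) * (M / y) powr (e / 2)"
      by (simp add: algebra_simps)
    have "(M / y)\<^sup>2 * (1 + ln (M / y)) * n i \<le> (M / y)\<^sup>2 * (1 + ln (M / y)) * (B * y powr (2 + e))"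
      using n[OF i] z by (intro mult_left_mono) (auto simp: y_def)
    also have "\<dots> \<le> (M / y)\<^sup>2 * ((1 + 2 / e) * (M / y) powr (e / 2)) * (B * y powr (2 + e))"
      using l assms by (intro mult_right_mono mult_left_mono) auto
    also have "\<dots> = (1 + 2 / e) * B * ((M / y) powr 2 * (M / y) powr (e / 2) * y powr (2 + e))"
      using z by simp
    also have "(M / y) powr 2 * (M / y) powr (e / 2) * y powr (2 + e) = M powr (2 + e) * (y / M) powr (e / 2)"
    proof -
      have "(M / y) powr 2 * (M / y) powr (e / 2) * y powr (2 + e) = (M / y) powr (2 + e / 2) * y powr (2 + e)"
        by (simp add: powr_add)
      also have "\<dots> = exp ((2 + e / 2) * (ln M - ln y) + (2 + e) * ln y)"
        using y assms by (simp add: powr_def ln_div exp_add)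
      also have "(2 + e / 2) * (ln M - ln y) + (2 + e) * ln y = (2 + e) * ln M + e / 2 * (ln y - ln M)"
        by (simp add: field_simps)
      also have "exp \<dots> = M powr (2 + e) * (y / M) powr (e / 2)"
        using y assms by (simp add: powr_def ln_div exp_add)
      finally show ?thesis .
    qed
    finally show "(M / 2 ^ i)\<^sup>2 * (1 + ln (M / 2 ^ i)) * n i \<le> (1 + 2 / e) * B * M powr (2 + e) * (2 ^ i / M) powr (e / 2)"
      by (simp add: y_def mult_ac)
  qed
  also have "\<dots> = (1 + 2 / e) * B * M powr (2 + e) * (\<Sum>i | 2 ^ i * K \<le> M. (2 ^ i / M) powr (e / 2))"
    by (simp add: sum_distrib_left)
  also have "\<dots> \<le> (1 + 2 / e) * B * M powr (2 + e) * (2 powr (e / 2) / (2 powr (e / 2) - 1) * K powr (- (e / 2)))"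
    using assms by (intro mult_left_mono sum_dyadic_le) auto
  finally show ?thesis by (simp add: mult_ac)
qed

context curved_arc
begin

text \<open>The tolerance \<eta> is fixed before \<open>e\<close>; only \<open>K\<close>, and with
  it \<open>B\<close>, depends on \<open>e\<close>. The bound is proved first for the integer shells
  by induction on the scale, and one more use of \<open>descent\<close> then handles arbitrary
  shifts.\<close>

lemma near_equal_count:
  assumes \<omega>: "\<omega> \<ge> 2"
  shows "\<exists>\<eta>>0. \<forall>e>0. \<exists>B>0. \<forall>M\<ge>1. \<forall>\<theta>1 \<theta>2 W. finite W \<longrightarrow>
    (\<forall>(m1, m2, m3, m4)\<in>W. near_equal (\<eta> / M) (of_int m1 + \<theta>1) (of_int m2 + \<theta>2) (of_int m3 + \<theta>1) (of_int m4 + \<theta>2)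
        \<and> M \<le> of_int m1 + \<theta>1 \<and> of_int m1 + \<theta>1 \<le> \<omega> * M) \<longrightarrow>
    real (card W) \<le> B * M powr (2 + e)"
proof -
  obtain \<eta> C K0 where \<eta>: "\<eta> > 0" and C: "C > 0" and
    D: "\<forall>K\<ge>K0. \<forall>M\<ge>1. \<forall>\<theta>1 \<theta>2 W. finite W \<longrightarrow>
    (\<forall>(m1, m2, m3, m4)\<in>W. near_equal (\<eta> / M) (of_int m1 + \<theta>1) (of_int m2 + \<theta>2) (of_int m3 + \<theta>1) (of_int m4 + \<theta>2)
        \<and> M \<le> of_int m1 + \<theta>1 \<and> of_int m1 + \<theta>1 \<le> \<omega> * M) \<longrightarrow>
    real (card W) \<le> C * K * M\<^sup>2 +
      C * (\<Sum>i | 2 ^ i * K \<le> M. (M / 2 ^ i)\<^sup>2 * (1 + ln (M / 2 ^ i)) * real (card (shell \<eta> i)))"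
    using descent[OF \<omega>] by (elim exE conjE)
  have "\<exists>B>0. \<forall>M\<ge>1. \<forall>\<theta>1 \<theta>2 W. finite W \<longrightarrow>
    (\<forall>(m1, m2, m3, m4)\<in>W. near_equal (\<eta> / M) (of_int m1 + \<theta>1) (of_int m2 + \<theta>2) (of_int m3 + \<theta>1) (of_int m4 + \<theta>2)
        \<and> M \<le> of_int m1 + \<theta>1 \<and> of_int m1 + \<theta>1 \<le> \<omega> * M) \<longrightarrow>
    real (card W) \<le> B * M powr (2 + e)" if e: "e > 0" for e :: real
  proof -
    define G where "G = (1 + 2 / e) * (2 powr (e / 2) / (2 powr (e / 2) - 1))"
    have "2 powr (e / 2) > 1" using e by simp
    then have G: "G > 0" using e unfolding G_def by (intro mult_pos_pos add_pos_pos divide_pos_pos) auto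
    \<comment> \<open>The last entry forces \<open>2 * C * G * K powr (- e / 2)\<close> \<le> 1, so
      the recursive sum uses at most half of the target bound. With \<open>B = 2 * C * K\<close> the
      direct term uses the other half.\<close>
    define K where "K = max (max K0 2) ((2 * C * G) powr (2 / e))"
    have K: "K \<ge> K0" "K \<ge> 2" "K \<ge> (2 * C * G) powr (2 / e)" by (auto simp: K_def)
    have "2 * C * G = ((2 * C * G) powr (2 / e)) powr (e / 2)" using C G e by (simp add: powr_powr)
    also have "\<dots> \<le> K powr (e / 2)" using K e by (intro powr_mono2) auto
    finally have KG: "2 * C * G * K powr (- e / 2) \<le> 1"
      using K by (simp add: powr_minus field_simps)
    define B where "B = 2 * C * K"
    have B: "B > 0" using C K by (simp add: B_def)
    have step: "real (card W) \<le> B * M powr (2 + e)"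
      if M: "M \<ge> 1" and fin: "finite W" and W: "\<forall>(m1, m2, m3, m4)\<in>W. near_equal (\<eta> / M) (of_int m1 + \<theta>1) (of_int m2 + \<theta>2) (of_int m3 + \<theta>1) (of_int m4 + \<theta>2)
        \<and> M \<le> of_int m1 + \<theta>1 \<and> of_int m1 + \<theta>1 \<le> \<omega> * M"
        and sh: "\<And>i. 2 ^ i * K \<le> M \<Longrightarrow> real (card (shell \<eta> i)) \<le> B * (2 ^ i) powr (2 + e)"
      for M \<theta>1 \<theta>2 W
    proof -
      have "real (card W) \<le> C * K * M\<^sup>2 +
        C * (\<Sum>i | 2 ^ i * K \<le> M. (M / 2 ^ i)\<^sup>2 * (1 + ln (M / 2 ^ i)) * real (card (shell \<eta> i)))"
        by (rule D[THEN spec, THEN mp, OF K(1), THEN spec, THEN mp, OF M, THEN spec, THEN spec, THEN spec,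
              THEN mp, OF fin, THEN mp, OF W])
      also have "(\<Sum>i | 2 ^ i * K \<le> M. (M / 2 ^ i)\<^sup>2 * (1 + ln (M / 2 ^ i)) * real (card (shell \<eta> i)))
          \<le> G * B * K powr (- e / 2) * M powr (2 + e)"
        unfolding G_def using sh e K M B by (intro descent_sum_le) auto
      then have "C * (\<Sum>i | 2 ^ i * K \<le> M. (M / 2 ^ i)\<^sup>2 * (1 + ln (M / 2 ^ i)) * real (card (shell \<eta> i)))
          \<le> C * (G * B * K powr (- e / 2) * M powr (2 + e))"
        using C by (intro mult_left_mono) auto
      also have "C * (G * B * K powr (- e / 2) * M powr (2 + e)) = (2 * C * G * K powr (- e / 2)) * (B / 2 * M powr (2 + e))"
        by (simp add: mult_ac)
      also have "\<dots> \<le> 1 * (B / 2 * M powr (2 + e))" using B by (intro mult_right_mono KG) auto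
      also have "C * K * M\<^sup>2 \<le> B / 2 * M powr (2 + e)"
      proof -
        have "M\<^sup>2 = M powr 2" using M by simp
        also have "\<dots> \<le> M powr (2 + e)" using M e by (intro powr_mono) auto
        finally have "C * K * M\<^sup>2 \<le> C * K * M powr (2 + e)" using C K by (intro mult_left_mono) auto
        then show ?thesis by (simp add: B_def)
      qed
      finally show ?thesis by simp
    qed
    \<comment> \<open>Since \<open>K\<close> \<ge> 2, the shells in the sum have index strictly
      below \<open>j\<close>. Within shell \<open>j\<close> the tolerance \<eta> / a is at most
      \<eta> / 2^j, so \<open>descent\<close> applies at M = 2^j with no shift.\<close>
    have shells: "real (card (shell \<eta> j)) \<le> B * (2 ^ j) powr (2 + e)" for j
    proof (induction j rule: less_induct)
      case (less j)
      show ?case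
      proof (rule step[where ?\<theta>1.0 = 0 and ?\<theta>2.0 = 0])
        show "\<forall>(m1, m2, m3, m4)\<in>shell \<eta> j. near_equal (\<eta> / 2 ^ j) (of_int m1 + 0) (of_int m2 + 0) (of_int m3 + 0) (of_int m4 + 0)
          \<and> 2 ^ j \<le> of_int m1 + (0::real) \<and> of_int m1 + 0 \<le> \<omega> * 2 ^ j"
        proof (clarsimp simp: shell_def)
          fix a b c d :: int
          assume a: "2 ^ j \<le> a" "real_of_int a < 2 * 2 ^ j"
            and near: "near_equal (\<eta> / real_of_int a) (real_of_int a) (real_of_int b) (real_of_int c) (real_of_int d)"
          have a': "(2::real) ^ j \<le> real_of_int a" using a(1) by (metis of_int_le_iff of_int_numeral of_int_power)
          have "0 < real_of_int a" by (rule less_le_trans[OF _ a']) simp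
          then have "\<eta> / real_of_int a \<le> \<eta> / 2 ^ j" using a' \<eta> by (intro divide_left_mono mult_pos_pos) auto
          moreover have "2 * 2 ^ j \<le> \<omega> * 2 ^ j" using \<omega> by (intro mult_right_mono) auto
          with a(2) have "real_of_int a \<le> \<omega> * 2 ^ j" by (rule order.trans[OF less_imp_le])
          ultimately show "near_equal (\<eta> / 2 ^ j) (real_of_int a) (real_of_int b) (real_of_int c) (real_of_int d)
              \<and> real_of_int a \<le> \<omega> * 2 ^ j"
            using near a unfolding near_equal_def by auto
        qed
        fix i :: nat assume i: "2 ^ i * K \<le> 2 ^ j"
        have "(2::real) ^ i * 2 \<le> 2 ^ i * K" using K by (intro mult_left_mono) auto
        also note i
        finally have "(2::real) ^ Suc i \<le> 2 ^ j" by simp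
        then have "Suc i \<le> j" by (rule power_le_imp_le_exp[rotated]) simp
        then show "real (card (shell \<eta> i)) \<le> B * (2 ^ i) powr (2 + e)" by (intro less.IH) simp
      qed (auto simp: finite_shell)
    qed
    show ?thesis
    proof (rule exI[of _ B], intro conjI B allI impI)
      fix M \<theta>1 \<theta>2 W
      assume "1 \<le> M" "finite W" "\<forall>(m1, m2, m3, m4)\<in>W. near_equal (\<eta> / M) (of_int m1 + \<theta>1) (of_int m2 + \<theta>2) (of_int m3 + \<theta>1) (of_int m4 + \<theta>2)
        \<and> M \<le> of_int m1 + \<theta>1 \<and> of_int m1 + \<theta>1 \<le> \<omega> * M"
      then show "real (card W) \<le> B * M powr (2 + e)" using shells by (rule step)
    qed
  qed
  then show ?thesis using \<eta> by blast
qed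

end

section \<open>Reduction to near coincidences of a power mean\<close>

text \<open>Sort the values into bins of length \<open>h\<close>. By 2 r r' \<le> r^2 + r'^2, the
  pairs at any fixed bin offset are no more numerous than the pairs within one bin, all of which
  differ by at most \<open>h\<close>. A difference of at most \<Delta> allows at most 2 \<Delta> / h
  + 3 offsets.\<close>

lemma card_close_pairs_le:
  fixes v :: "'a \<Rightarrow> real"
  assumes A: "finite A" and h: "h > 0" and \<Delta>: "\<Delta> \<ge> 0"
  shows "real (card {(p, p') \<in> A \<times> A. \<bar>v p - v p'\<bar> \<le> \<Delta>})
    \<le> (2 * \<Delta> / h + 3) * real (card {(p, p') \<in> A \<times> A. \<bar>v p - v p'\<bar> \<le> h})"
proof -
  define idx where "idx = (\<lambda>p. \<lfloor>v p / h\<rfloor>)"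
  define r where "r = (\<lambda>i. real (card {p \<in> A. idx p = i}))"
  define T where "T = (\<lambda>k. {(p, p') \<in> A \<times> A. idx p' = idx p + k})"
  define n where "n = \<lfloor>\<Delta> / h\<rfloor> + 1"
  have n: "n \<ge> 1" using h \<Delta> by (simp add: n_def)
  have finT: "finite (T k)" for k
    by (rule finite_subset[of _ "A \<times> A"]) (use A in \<open>auto simp: T_def\<close>)
  have cardT: "real (card (T k)) = (\<Sum>i\<in>idx ` A. r i * r (i + k))" for k
  proof -
    have "T k = (\<Union>i\<in>idx ` A. {p \<in> A. idx p = i} \<times> {p \<in> A. idx p = i + k})"
      by (auto simp: T_def)
    also have "card \<dots> = (\<Sum>i\<in>idx ` A. card ({p \<in> A. idx p = i} \<times> {p \<in> A. idx p = i + k}))"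
      using A by (intro card_UN_disjoint) auto
    finally show ?thesis by (simp add: r_def card_cartesian_product)
  qed
  have shift: "(\<Sum>i\<in>idx ` A. (r (i + k))\<^sup>2) \<le> (\<Sum>i\<in>idx ` A. (r i)\<^sup>2)" for k
  proof -
    have "(\<Sum>i\<in>idx ` A. (r (i + k))\<^sup>2) = (\<Sum>j\<in>(\<lambda>i. i + k) ` idx ` A. (r j)\<^sup>2)"
      by (subst sum.reindex) (auto simp: inj_on_def)
    also have "\<dots> \<le> (\<Sum>j\<in>(\<lambda>i. i + k) ` idx ` A \<union> idx ` A. (r j)\<^sup>2)"
      using A by (intro sum_mono2) auto
    also have "\<dots> = (\<Sum>j\<in>idx ` A. (r j)\<^sup>2)"
    proof (rule sum.mono_neutral_right)
      show "\<forall>j\<in>(\<lambda>i. i + k) ` idx ` A \<union> idx ` A - idx ` A. (r j)\<^sup>2 = 0"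
      proof
        fix j assume "j \<in> (\<lambda>i. i + k) ` idx ` A \<union> idx ` A - idx ` A"
        then have e: "{p \<in> A. idx p = j} = {}" by auto
        show "(r j)\<^sup>2 = 0" unfolding r_def e by simp
      qed
    qed (use A in auto)
    finally show ?thesis .
  qed
  have T_le: "real (card (T k)) \<le> real (card (T 0))" for k
  proof -
    have "(\<Sum>i\<in>idx ` A. r i * r (i + k)) \<le> (\<Sum>i\<in>idx ` A. ((r i)\<^sup>2 + (r (i + k))\<^sup>2) / 2)"
    proof (rule sum_mono)
      fix i
      have "0 \<le> (r i - r (i + k))\<^sup>2" by simp
      then show "r i * r (i + k) \<le> ((r i)\<^sup>2 + (r (i + k))\<^sup>2) / 2" by (simp add: power2_diff)
    qed
    also have "\<dots> = ((\<Sum>i\<in>idx ` A. (r i)\<^sup>2) + (\<Sum>i\<in>idx ` A. (r (i + k))\<^sup>2)) / 2"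
      by (simp add: sum.distrib flip: sum_divide_distrib)
    also have "\<dots> \<le> (\<Sum>i\<in>idx ` A. (r i)\<^sup>2)" using shift[of k] by simp
    finally show ?thesis by (simp add: cardT power2_eq_square)
  qed
  have "{(p, p') \<in> A \<times> A. \<bar>v p - v p'\<bar> \<le> \<Delta>} \<subseteq> (\<Union>k\<in>{-n..n}. T k)"
  proof clarsimp
    fix p p' assume p: "p \<in> A" "p' \<in> A" "\<bar>v p - v p'\<bar> \<le> \<Delta>"
    have "\<bar>v p' / h - v p / h\<bar> \<le> \<Delta> / h"
      using p h by (simp add: abs_minus_commute divide_right_mono flip: diff_divide_distrib)
    then have "idx p' - idx p \<in> {-n..n}" unfolding idx_def n_def by simp linarith
    then show "\<exists>k\<in>{-n..n}. (p, p') \<in> T k" using p by (intro bexI[of _ "idx p' - idx p"]) (auto simp: T_def)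
  qed
  then have "card {(p, p') \<in> A \<times> A. \<bar>v p - v p'\<bar> \<le> \<Delta>} \<le> card (\<Union>k\<in>{-n..n}. T k)"
    using finT by (intro card_mono) auto
  also have "\<dots> \<le> (\<Sum>k\<in>{-n..n}. card (T k))" by (rule card_UN_le) simp
  finally have "real (card {(p, p') \<in> A \<times> A. \<bar>v p - v p'\<bar> \<le> \<Delta>}) \<le> real (\<Sum>k\<in>{-n..n}. card (T k))"
    by (rule of_nat_mono)
  also have "\<dots> = (\<Sum>k\<in>{-n..n}. real (card (T k)))" by (rule of_nat_sum)
  also have "\<dots> \<le> (\<Sum>k\<in>{-n..n}. real (card (T 0)))" by (intro sum_mono T_le)
  also have "\<dots> = (2 * real_of_int n + 1) * real (card (T 0))" using n by (simp add: of_nat_nat)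
  also have "\<dots> \<le> (2 * \<Delta> / h + 3) * real (card {(p, p') \<in> A \<times> A. \<bar>v p - v p'\<bar> \<le> h})"
  proof (intro mult_mono)
    have "real_of_int n \<le> \<Delta> / h + 1" unfolding n_def by simp
    then show "2 * real_of_int n + 1 \<le> 2 * \<Delta> / h + 3" by simp
    have "T 0 \<subseteq> {(p, p') \<in> A \<times> A. \<bar>v p - v p'\<bar> \<le> h}"
    proof (clarsimp simp: T_def)
      fix p p' assume "idx p' = idx p"
      then have "\<bar>v p / h - v p' / h\<bar> \<le> 1" unfolding idx_def by linarith
      then have "\<bar>v p - v p'\<bar> / h \<le> 1" using h by (simp flip: diff_divide_distrib)
      then show "\<bar>v p - v p'\<bar> \<le> h" using h by simp
    qed
    then have "card (T 0) \<le> card {(p, p') \<in> A \<times> A. \<bar>v p - v p'\<bar> \<le> h}"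
      by (intro card_mono finite_subset[of "{(p, p') \<in> A \<times> A. \<bar>v p - v p'\<bar> \<le> h}" "A \<times> A"]) (use A in auto)
    then show "real (card (T 0)) \<le> real (card {(p, p') \<in> A \<times> A. \<bar>v p - v p'\<bar> \<le> h})" by simp
  qed (use h \<Delta> in auto)
  finally show ?thesis .
qed

lemma positive_continuous_bounds:
  fixes f :: "real \<Rightarrow> real"
  assumes "u \<le> v" "\<And>x. x \<in> {u..v} \<Longrightarrow> isCont f x" "\<And>x. x \<in> {u..v} \<Longrightarrow> f x > 0"
  shows "\<exists>l>0. \<exists>b>0. \<forall>x\<in>{u..v}. l \<le> f x \<and> f x \<le> b"
proof -
  obtain L M where LM: "\<forall>x. u \<le> x \<and> x \<le> v \<longrightarrow> L \<le> f x \<and> f x \<le> M" "\<forall>y. L \<le> y \<and> y \<le> M \<longrightarrow> (\<exists>x\<ge>u. x \<le> v \<and> f x = y)"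
    using isCont_Lb_Ub[of u v f] assms by auto
  have "L \<le> M" using LM(1) assms(1) by force
  then obtain x where "x \<ge> u" "x \<le> v" "f x = L" using LM(2) by auto
  then have "L > 0" using assms(3)[of x] by auto
  then show ?thesis using LM(1) \<open>L \<le> M\<close> by (intro exI[of _ L] conjI exI[of _ M]) auto
qed

lemma Lipschitz_from_deriv:
  fixes f :: "real \<Rightarrow> real"
  assumes "\<And>x. x \<in> {u..v} \<Longrightarrow> (f has_real_derivative f' x) (at x)" "\<And>x. x \<in> {u..v} \<Longrightarrow> \<bar>f' x\<bar> \<le> L"
    and xy: "x \<in> {u..v}" "y \<in> {u..v}"
  shows "\<bar>f x - f y\<bar> \<le> L * \<bar>x - y\<bar>"
proof -
  have *: "\<bar>f b - f a\<bar> \<le> L * \<bar>b - a\<bar>" if ab: "a \<in> {u..v}" "b \<in> {u..v}" "a < b" for a b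
  proof -
    obtain z where z: "a < z" "z < b" "f b - f a = (b - a) * f' z"
      using MVT2[of a b f f'] assms(1) ab by auto
    have "\<bar>f' z\<bar> \<le> L" using assms(2) z ab by auto
    then show ?thesis unfolding z(3) by (simp add: abs_mult mult.commute mult_right_mono)
  qed
  consider "x < y" | "x = y" | "y < x" by linarith
  then show ?thesis using *[of x y] *[of y x] xy by cases (auto simp: abs_minus_commute)
qed

lemma powr_Lipschitz:
  fixes p :: real
  assumes "0 < u" "u \<le> v"
  shows "\<exists>L>0. \<forall>x\<in>{u..v}. \<forall>y\<in>{u..v}. \<bar>x powr p - y powr p\<bar> \<le> L * \<bar>x - y\<bar>"
proof -
  have "\<exists>l>0. \<exists>b>0. \<forall>x\<in>{u..v}. l \<le> x powr (p - 1) \<and> x powr (p - 1) \<le> b"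
    by (rule positive_continuous_bounds) (use assms in \<open>auto intro!: continuous_intros\<close>)
  then obtain b where b: "b > 0" "\<And>x. x \<in> {u..v} \<Longrightarrow> x powr (p - 1) \<le> b" by blast
  have "\<bar>x powr p - y powr p\<bar> \<le> (\<bar>p\<bar> * b + 1) * \<bar>x - y\<bar>" if "x \<in> {u..v}" "y \<in> {u..v}" for x y
  proof (rule Lipschitz_from_deriv[OF _ _ that])
    fix z assume z: "z \<in> {u..v}"
    then show "((\<lambda>x. x powr p) has_real_derivative p * z powr (p - 1)) (at z)"
      using assms by (intro has_real_derivative_powr) auto
    have "\<bar>p\<bar> * z powr (p - 1) \<le> \<bar>p\<bar> * b" using b(2)[OF z] by (intro mult_left_mono) auto
    then show "\<bar>p * z powr (p - 1)\<bar> \<le> \<bar>p\<bar> * b + 1" by (simp add: abs_mult)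
  qed
  moreover have "\<bar>p\<bar> * b + 1 > 0" using b by (intro add_nonneg_pos) auto
  ultimately show ?thesis by blast
qed

text \<open>The profile is \<mu>(s) = g(1, s) for the power mean g. The slopes 1/6 to 6 are those of
  points with both coordinates between M / 2 and 3 M, and \<Gamma> \<ge> 6 covers the ratio of first
  coordinates of two such points. The margin 1/12 keeps the widened range away from 0, where the
  powers may be singular.\<close>

lemma curved_arc_power_mean:
  fixes \<alpha> \<beta> :: real
  assumes \<alpha>: "\<alpha> \<noteq> 0" "\<alpha> \<noteq> 1" and \<beta>: "\<beta> > 0"
  defines "h \<equiv> \<lambda>s. 1 + \<beta> * s powr \<alpha>"
  shows "\<exists>lam Lam b B L \<Gamma>. \<Gamma> \<ge> 6 \<and>
    curved_arc (\<lambda>s. h s powr (1 / \<alpha>)) (\<lambda>s. \<beta> * (h s powr (1 / \<alpha> - 1) * s powr (\<alpha> - 1)))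
      (\<lambda>s. \<beta> * (\<alpha> - 1) * (h s powr (1 / \<alpha> - 2) * s powr (\<alpha> - 2))) (sgn (\<alpha> - 1))
      (1 / 12) (6 + 1 / 12) lam Lam (1 / 6) 6 (1 / 12) b B L \<Gamma>"
proof -
  let ?J = "{1 / 12..6 + 1 / 12::real}"
  have h: "h s > 0" for s using \<beta> by (simp add: h_def add_pos_nonneg)
  have dh: "(h has_real_derivative \<beta> * (\<alpha> * s powr (\<alpha> - 1))) (at s)" if "s > 0" for s
    unfolding h_def using that by (auto intro!: derivative_eq_intros simp: powr_diff)
  have dhp: "((\<lambda>s. h s powr p) has_real_derivative p * h s powr (p - 1) * (\<beta> * (\<alpha> * s powr (\<alpha> - 1)))) (at s)" if "s > 0" for s p
    by (rule DERIV_chain2[OF has_real_derivative_powr[OF h] dh[OF that]])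
  have d1: "((\<lambda>s. h s powr (1 / \<alpha>)) has_real_derivative \<beta> * (h s powr (1 / \<alpha> - 1) * s powr (\<alpha> - 1))) (at s)" if "s > 0" for s
    using dhp[OF that, of "1 / \<alpha>"] \<alpha> by (simp add: mult_ac)
  have d2: "((\<lambda>s. \<beta> * (h s powr (1 / \<alpha> - 1) * s powr (\<alpha> - 1))) has_real_derivative
      \<beta> * (\<alpha> - 1) * (h s powr (1 / \<alpha> - 2) * s powr (\<alpha> - 2))) (at s)" if s: "s > 0" for s
  proof (rule DERIV_cong)
    show "((\<lambda>s. \<beta> * (h s powr (1 / \<alpha> - 1) * s powr (\<alpha> - 1))) has_real_derivative
      \<beta> * (((1 / \<alpha> - 1) * h s powr (1 / \<alpha> - 1 - 1) * (\<beta> * (\<alpha> * s powr (\<alpha> - 1)))) * s powr (\<alpha> - 1)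
        + ((\<alpha> - 1) * s powr (\<alpha> - 1 - 1)) * h s powr (1 / \<alpha> - 1))) (at s)"
      by (intro DERIV_cmult DERIV_mult dhp has_real_derivative_powr s)
    have e1: "h s powr (1 / \<alpha> - 1) = h s powr (1 / \<alpha> - 2) * h s"
      using powr_add[of "h s" "1 / \<alpha> - 2" 1] h[of s] by simp
    have e2: "s powr (\<alpha> - 1) * s powr (\<alpha> - 1) = s powr (\<alpha> - 2) * s powr \<alpha>"
      by (simp flip: powr_add)
    have "\<beta> * (((1 / \<alpha> - 1) * h s powr (1 / \<alpha> - 1 - 1) * (\<beta> * (\<alpha> * s powr (\<alpha> - 1)))) * s powr (\<alpha> - 1)
        + ((\<alpha> - 1) * s powr (\<alpha> - 1 - 1)) * h s powr (1 / \<alpha> - 1))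
      = \<beta> * (((1 / \<alpha> - 1) * \<alpha> * \<beta>) * h s powr (1 / \<alpha> - 2) * (s powr (\<alpha> - 1) * s powr (\<alpha> - 1))
        + (\<alpha> - 1) * s powr (\<alpha> - 2) * (h s powr (1 / \<alpha> - 2) * h s))"
      by (simp add: e1 mult_ac)
    also have "(1 / \<alpha> - 1) * \<alpha> = - (\<alpha> - 1)" using \<alpha> by (simp add: field_simps)
    also have "\<beta> * ((- (\<alpha> - 1) * \<beta>) * h s powr (1 / \<alpha> - 2) * (s powr (\<alpha> - 1) * s powr (\<alpha> - 1))
        + (\<alpha> - 1) * s powr (\<alpha> - 2) * (h s powr (1 / \<alpha> - 2) * h s))
      = \<beta> * (\<alpha> - 1) * (h s powr (1 / \<alpha> - 2) * s powr (\<alpha> - 2)) * (h s - \<beta> * s powr \<alpha>)"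
      unfolding e2 by (simp add: algebra_simps)
    \<comment> \<open>This cancellation turns the two terms of the second derivative into a single
      product, whose sign is that of \<beta> (\<alpha> - 1); hence the curvature never
      vanishes.\<close>
    also have "h s - \<beta> * s powr \<alpha> = 1" by (simp add: h_def)
    finally show "\<beta> * (((1 / \<alpha> - 1) * h s powr (1 / \<alpha> - 1 - 1) * (\<beta> * (\<alpha> * s powr (\<alpha> - 1)))) * s powr (\<alpha> - 1)
        + ((\<alpha> - 1) * s powr (\<alpha> - 1 - 1)) * h s powr (1 / \<alpha> - 1))
      = \<beta> * (\<alpha> - 1) * (h s powr (1 / \<alpha> - 2) * s powr (\<alpha> - 2))" by simp
  qed
  have chp: "isCont (\<lambda>s. h s powr p) s" if "s > 0" for s p using dhp[OF that] by (rule DERIV_isCont)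
  have cp: "isCont (\<lambda>s. s powr p) s" if "s > 0" for s p :: real using that by (intro continuous_intros) auto
  have hp: "h s powr p > 0" for s p using h[of s] by simp
  have "\<exists>b>0. \<exists>B>0. \<forall>s\<in>?J. b \<le> h s powr (1 / \<alpha>) \<and> h s powr (1 / \<alpha>) \<le> B"
    by (rule positive_continuous_bounds) (use chp hp in auto)
  then obtain b B where bB: "b > 0" "\<And>s. s \<in> ?J \<Longrightarrow> b \<le> h s powr (1 / \<alpha>) \<and> h s powr (1 / \<alpha>) \<le> B" by blast
  have "\<exists>l>0. \<exists>L>0. \<forall>s\<in>?J. l \<le> h s powr (1 / \<alpha> - 1) * s powr (\<alpha> - 1) \<and> h s powr (1 / \<alpha> - 1) * s powr (\<alpha> - 1) \<le> L"
    by (rule positive_continuous_bounds) (use chp cp hp in \<open>auto intro!: continuous_mult mult_pos_pos\<close>)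
  then obtain L where L: "L > 0" "\<And>s. s \<in> ?J \<Longrightarrow> h s powr (1 / \<alpha> - 1) * s powr (\<alpha> - 1) \<le> L" by blast
  have "\<exists>l>0. \<exists>u>0. \<forall>s\<in>?J. l \<le> h s powr (1 / \<alpha> - 2) * s powr (\<alpha> - 2) \<and> h s powr (1 / \<alpha> - 2) * s powr (\<alpha> - 2) \<le> u"
    by (rule positive_continuous_bounds) (use chp cp hp in \<open>auto intro!: continuous_mult mult_pos_pos\<close>)
  then obtain l u where lu: "l > 0" "u > 0"
    "\<And>s. s \<in> ?J \<Longrightarrow> l \<le> h s powr (1 / \<alpha> - 2) * s powr (\<alpha> - 2) \<and> h s powr (1 / \<alpha> - 2) * s powr (\<alpha> - 2) \<le> u" by blast
  have pos: "s > 0" if "s \<in> ?J" for s using that by simp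
  have sg: "sgn (\<alpha> - 1) * (\<beta> * (\<alpha> - 1) * t) = \<beta> * \<bar>\<alpha> - 1\<bar> * t" for t
    by (simp add: sgn_if)
  have a1: "\<beta> * \<bar>\<alpha> - 1\<bar> > 0" using \<alpha> \<beta> by simp
  have lip: "\<bar>h s powr (1 / \<alpha>) - h t powr (1 / \<alpha>)\<bar> \<le> (\<beta> * L) * \<bar>s - t\<bar>" if "s \<in> ?J" "t \<in> ?J" for s t
  proof (rule Lipschitz_from_deriv[OF d1[OF pos] _ that])
    fix x assume x: "x \<in> ?J"
    show "\<bar>\<beta> * (h x powr (1 / \<alpha> - 1) * x powr (\<alpha> - 1))\<bar> \<le> \<beta> * L"
      using L(2)[OF x] \<beta> by (simp add: abs_mult)
  qed
  have arc: "curved_arc (\<lambda>s. h s powr (1 / \<alpha>)) (\<lambda>s. \<beta> * (h s powr (1 / \<alpha> - 1) * s powr (\<alpha> - 1)))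
      (\<lambda>s. \<beta> * (\<alpha> - 1) * (h s powr (1 / \<alpha> - 2) * s powr (\<alpha> - 2))) (sgn (\<alpha> - 1))
      (1 / 12) (6 + 1 / 12) (\<beta> * \<bar>\<alpha> - 1\<bar> * l) (\<beta> * \<bar>\<alpha> - 1\<bar> * u) (1 / 6) 6 (1 / 12) b B (\<beta> * L) (max 6 (2 * B / b))"
  proof
    fix s assume s: "s \<in> ?J"
    show "((\<lambda>s. h s powr (1 / \<alpha>)) has_real_derivative \<beta> * (h s powr (1 / \<alpha> - 1) * s powr (\<alpha> - 1))) (at s)"
      by (rule d1[OF pos[OF s]])
    show "((\<lambda>s. \<beta> * (h s powr (1 / \<alpha> - 1) * s powr (\<alpha> - 1))) has_real_derivative
      \<beta> * (\<alpha> - 1) * (h s powr (1 / \<alpha> - 2) * s powr (\<alpha> - 2))) (at s)"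
      by (rule d2[OF pos[OF s]])
    show "\<beta> * \<bar>\<alpha> - 1\<bar> * l \<le> sgn (\<alpha> - 1) * (\<beta> * (\<alpha> - 1) * (h s powr (1 / \<alpha> - 2) * s powr (\<alpha> - 2)))"
      "sgn (\<alpha> - 1) * (\<beta> * (\<alpha> - 1) * (h s powr (1 / \<alpha> - 2) * s powr (\<alpha> - 2))) \<le> \<beta> * \<bar>\<alpha> - 1\<bar> * u"
      unfolding sg using lu(3)[OF s] a1 by (auto intro!: mult_left_mono)
    show "b \<le> h s powr (1 / \<alpha>)" "h s powr (1 / \<alpha>) \<le> B" using bB(2)[OF s] by auto
  next
    fix s t assume st: "s \<in> ?J" "t \<in> ?J"
    show "\<bar>h s powr (1 / \<alpha>) - h t powr (1 / \<alpha>)\<bar> \<le> \<beta> * L * \<bar>s - t\<bar>" by (rule lip[OF st])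
  next
    show "\<bar>sgn (\<alpha> - 1)\<bar> = 1" using \<alpha> by (simp add: sgn_if)
    show "0 < \<beta> * \<bar>\<alpha> - 1\<bar> * l" "0 < \<beta> * \<bar>\<alpha> - 1\<bar> * u" using a1 lu by simp_all
    show "0 < \<beta> * L" using \<beta> L by simp
  qed (use bB in auto)
  show ?thesis by (rule exI)+ (rule conjI[OF max.cobounded1 arc])
qed

section \<open>Counting the solutions\<close>

lemma approx_count_le_box: "real (approx_count \<theta>1 \<theta>2 \<beta> M \<alpha> \<delta>) \<le> (real M + 1) ^ 4"
proof -
  let ?I = "{int M..2 * int M}"
  have "approx_count \<theta>1 \<theta>2 \<beta> M \<alpha> \<delta> \<le> card (?I \<times> ?I \<times> ?I \<times> ?I)"
    unfolding approx_count_def by (intro card_mono) (auto simp: approx_solutions_def)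
  also have "\<dots> = (M + 1) ^ 4" by (simp add: eval_nat_numeral nat_add_distrib mult_ac)
  finally show ?thesis by (metis of_nat_le_iff of_nat_power of_nat_add of_nat_1)
qed

lemma approx_count_uminus: "approx_count \<theta>1 \<theta>2 (- \<beta>) M \<alpha> \<delta> = approx_count \<theta>1 \<theta>2 \<beta> M \<alpha> \<delta>"
proof -
  have "bij_betw (\<lambda>(a, b, c, d). (a, b, d, c)) (approx_solutions \<theta>1 \<theta>2 (- \<beta>) M \<alpha> \<delta>) (approx_solutions \<theta>1 \<theta>2 \<beta> M \<alpha> \<delta>)"
    by (rule bij_betw_byWitness[where f' = "\<lambda>(a, b, c, d). (a, b, d, c)"])
       (auto simp: approx_solutions_def algebra_simps)
  then show ?thesis unfolding approx_count_def by (rule bij_betw_same_card)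
qed

lemma approx_count_pos_coeff:
  fixes \<theta>1 \<theta>2 \<alpha> \<beta> \<epsilon> :: real
  assumes \<alpha>: "\<alpha> \<noteq> 0" "\<alpha> \<noteq> 1" and \<beta>: "\<beta> > 0" and \<epsilon>: "\<epsilon> > 0"
  shows "\<exists>C>0. \<forall>(M::nat) (\<delta>::real). M > 0 \<and> 0 < \<delta> \<longrightarrow>
           real (approx_count \<theta>1 \<theta>2 \<beta> M \<alpha> \<delta>) \<le> C * (real M powr (2 + \<epsilon>) + \<delta> * real M powr (4 + \<epsilon>))"
proof -
  define h where "h = (\<lambda>s. 1 + \<beta> * s powr \<alpha>)"
  obtain lam Lam b B L \<Gamma> where \<Gamma>6: "\<Gamma> \<ge> 6" and arc:
    "curved_arc (\<lambda>s. h s powr (1 / \<alpha>)) (\<lambda>s. \<beta> * (h s powr (1 / \<alpha> - 1) * s powr (\<alpha> - 1)))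
      (\<lambda>s. \<beta> * (\<alpha> - 1) * (h s powr (1 / \<alpha> - 2) * s powr (\<alpha> - 2))) (sgn (\<alpha> - 1))
      (1 / 12) (6 + 1 / 12) lam Lam (1 / 6) 6 (1 / 12) b B L \<Gamma>"
    using curved_arc_power_mean[OF \<alpha> \<beta>] unfolding h_def by blast
  interpret curved_arc "\<lambda>s. h s powr (1 / \<alpha>)" "\<lambda>s. \<beta> * (h s powr (1 / \<alpha> - 1) * s powr (\<alpha> - 1))"
      "\<lambda>s. \<beta> * (\<alpha> - 1) * (h s powr (1 / \<alpha> - 2) * s powr (\<alpha> - 2))" "sgn (\<alpha> - 1)"
      "1 / 12" "6 + 1 / 12" lam Lam "1 / 6" 6 "1 / 12" b B L \<Gamma> by (rule arc)
  have six: "(2::real) \<le> 6" by simp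
  obtain \<eta> where \<eta>: "\<eta> > 0" and count: "\<forall>e>0. \<exists>B>0. \<forall>M\<ge>1. \<forall>\<theta>1 \<theta>2 W. finite W \<longrightarrow>
    (\<forall>(m1, m2, m3, m4)\<in>W. near_equal (\<eta> / M) (of_int m1 + \<theta>1) (of_int m2 + \<theta>2) (of_int m3 + \<theta>1) (of_int m4 + \<theta>2)
        \<and> M \<le> of_int m1 + \<theta>1 \<and> of_int m1 + \<theta>1 \<le> 6 * M) \<longrightarrow>
    real (card W) \<le> B * M powr (2 + e)"
    using near_equal_count[OF six] by (elim exE conjE)
  obtain D where D: "D > 0" and count': "\<forall>M\<ge>1. \<forall>\<theta>1 \<theta>2 W. finite W \<longrightarrow>
    (\<forall>(m1, m2, m3, m4)\<in>W. near_equal (\<eta> / M) (of_int m1 + \<theta>1) (of_int m2 + \<theta>2) (of_int m3 + \<theta>1) (of_int m4 + \<theta>2)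
        \<and> M \<le> of_int m1 + \<theta>1 \<and> of_int m1 + \<theta>1 \<le> 6 * M) \<longrightarrow>
    real (card W) \<le> D * M powr (2 + \<epsilon>)"
    using count[THEN spec, THEN mp, OF \<epsilon>] by (elim exE conjE)
  have "\<exists>l>0. \<exists>u>0. \<forall>t\<in>{1 / 2..3}. l \<le> t powr \<alpha> \<and> t powr \<alpha> \<le> u"
    by (rule positive_continuous_bounds) (auto intro!: continuous_intros)
  then obtain l u where lu: "l > 0" "u > 0" "\<And>t. t \<in> {1 / 2..3} \<Longrightarrow> l \<le> t powr \<alpha> \<and> t powr \<alpha> \<le> u" by blast
  have lu': "l \<le> u" using lu(3)[of 1] by simp
  \<comment> \<open>After division by M^\<alpha>, the values of \<open>F\<close> stay in a compact
    interval of positive numbers. There t^(1/\<alpha>) is Lipschitz, which converts the tolerance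
    \<delta> M^\<alpha> into Q \<delta> M for the homogeneous g.\<close>
  obtain Q where Q: "Q > 0" "\<And>x y. x \<in> {(1 + \<beta>) * l..(1 + \<beta>) * u} \<Longrightarrow> y \<in> {(1 + \<beta>) * l..(1 + \<beta>) * u} \<Longrightarrow>
      \<bar>x powr (1 / \<alpha>) - y powr (1 / \<alpha>)\<bar> \<le> Q * \<bar>x - y\<bar>"
    using powr_Lipschitz[of "(1 + \<beta>) * l" "(1 + \<beta>) * u" "1 / \<alpha>"] lu(1) lu' \<beta> by (auto simp: mult_left_mono)
  \<comment> \<open>Beyond \<open>M0\<close> the shifts are at most M / 2, so the coordinates lie
    between M / 2 and 3 M. Up to \<open>M0\<close> the trivial count is absorbed into
    \<open>C\<close>.\<close>
  define M0 where "M0 = nat \<lceil>2 * \<bar>\<theta>1\<bar> + 2 * \<bar>\<theta>2\<bar>\<rceil> + 2"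
  define C where "C = max ((real M0 + 1) ^ 4) ((Q / \<eta> + 3) * D)"
  have C: "C > 0" by (simp add: C_def less_max_iff_disj)
  show ?thesis
  proof (rule exI[of _ C], intro conjI C allI impI)
    fix M :: nat and \<delta> :: real
    assume M: "M > 0 \<and> 0 < \<delta>"
    then have M1: "real M \<ge> 1" and \<delta>: "\<delta> > 0" by auto
    show "real (approx_count \<theta>1 \<theta>2 \<beta> M \<alpha> \<delta>) \<le> C * (real M powr (2 + \<epsilon>) + \<delta> * real M powr (4 + \<epsilon>))"
    proof (cases "M \<le> M0")
      case True
      have "real (approx_count \<theta>1 \<theta>2 \<beta> M \<alpha> \<delta>) \<le> (real M + 1) ^ 4" by (rule approx_count_le_box)
      also have "\<dots> \<le> (real M0 + 1) ^ 4" using True by (intro power_mono) auto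
      also have "\<dots> \<le> C" by (simp add: C_def)
      also have "\<dots> = C * 1" by simp
      also have "\<dots> \<le> C * (real M powr (2 + \<epsilon>) + \<delta> * real M powr (4 + \<epsilon>))"
      proof (intro mult_left_mono)
        have "1 \<le> real M powr (2 + \<epsilon>)" using M1 \<epsilon> by (intro ge_one_powr_ge_zero) auto
        then show "1 \<le> real M powr (2 + \<epsilon>) + \<delta> * real M powr (4 + \<epsilon>)" using \<delta> by (simp add: add_increasing2)
      qed (use C in auto)
      finally show ?thesis .
    next
      case False
      then have big: "real M \<ge> 2 * \<bar>\<theta>1\<bar> + 2 * \<bar>\<theta>2\<bar>" "real M \<ge> 2" unfolding M0_def by linarith+
      define x1 x2 :: "int \<times> int \<Rightarrow> real" where "x1 = (\<lambda>p. of_int (fst p) + \<theta>1)" and "x2 = (\<lambda>p. of_int (snd p) + \<theta>2)"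
      define A where "A = {int M..2 * int M} \<times> {int M..2 * int M}"
      define v where "v = (\<lambda>p. gauge (x1 p) (x2 p))"
      have finA: "finite A" by (simp add: A_def)
      have size: "real M / 2 \<le> x1 p" "x1 p \<le> 3 * real M" "real M / 2 \<le> x2 p" "x2 p \<le> 3 * real M" if "p \<in> A" for p
      proof -
        have p: "real M \<le> of_int (fst p)" "of_int (fst p) \<le> 2 * real M" "real M \<le> of_int (snd p)" "of_int (snd p) \<le> 2 * real M"
          using that by (auto simp: A_def mem_Times_iff)
        show "real M / 2 \<le> x1 p" "x1 p \<le> 3 * real M" "real M / 2 \<le> x2 p" "x2 p \<le> 3 * real M"
          unfolding x1_def x2_def using p big by linarith+
      qed
      define F where "F = (\<lambda>p. x1 p powr \<alpha> + \<beta> * x2 p powr \<alpha>)"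
      have scaled: "F p / real M powr \<alpha> \<in> {(1 + \<beta>) * l..(1 + \<beta>) * u}" "v p / real M = (F p / real M powr \<alpha>) powr (1 / \<alpha>)"
        if p: "p \<in> A" for p
      proof -
        have pos: "x1 p > 0" "x2 p > 0" using size[OF p] M1 by linarith+
        have "x1 p / real M \<in> {1 / 2..3}" "x2 p / real M \<in> {1 / 2..3}"
          using size[OF p] M1 by (auto simp: field_simps)
        then have b: "l \<le> (x1 p / real M) powr \<alpha>" "(x1 p / real M) powr \<alpha> \<le> u"
          "l \<le> (x2 p / real M) powr \<alpha>" "(x2 p / real M) powr \<alpha> \<le> u" using lu(3) by blast+
        have Fe: "F p / real M powr \<alpha> = (x1 p / real M) powr \<alpha> + \<beta> * (x2 p / real M) powr \<alpha>"
          using pos M1 by (simp add: F_def powr_divide add_divide_distrib)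
        have "\<beta> * l \<le> \<beta> * (x2 p / real M) powr \<alpha>" "\<beta> * (x2 p / real M) powr \<alpha> \<le> \<beta> * u"
          using b \<beta> by (auto intro!: mult_left_mono)
        then show "F p / real M powr \<alpha> \<in> {(1 + \<beta>) * l..(1 + \<beta>) * u}"
          using b unfolding Fe by (simp add: distrib_right)
        \<comment> \<open>Factoring out the first coordinate exhibits
          \<open>F p powr (1 / \<alpha>)\<close> as the homogeneous function
          \<open>gauge\<close>.\<close>
        have "F p = x1 p powr \<alpha> * h (x2 p / x1 p)"
          using pos by (simp add: F_def h_def powr_divide field_simps)
        moreover have "h (x2 p / x1 p) > 0" using \<beta> by (simp add: h_def add_pos_nonneg)
        ultimately have "F p powr (1 / \<alpha>) = v p"
          using pos \<alpha> by (simp add: v_def gauge_def powr_mult powr_powr)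
        moreover have "F p \<ge> 0" using \<beta> by (simp add: F_def)
        ultimately show "v p / real M = (F p / real M powr \<alpha>) powr (1 / \<alpha>)"
          using \<alpha> M1 by (simp add: powr_divide powr_powr)
      qed
      have close: "\<bar>v p - v p'\<bar> \<le> Q * \<delta> * real M" if p: "p \<in> A" "p' \<in> A" "\<bar>F p - F p'\<bar> \<le> \<delta> * real M powr \<alpha>" for p p'
      proof -
        have "\<bar>v p / real M - v p' / real M\<bar> \<le> Q * \<bar>F p / real M powr \<alpha> - F p' / real M powr \<alpha>\<bar>"
          using scaled p Q(2) by auto
        also have "\<bar>F p / real M powr \<alpha> - F p' / real M powr \<alpha>\<bar> = \<bar>F p - F p'\<bar> / real M powr \<alpha>"
          by (simp flip: diff_divide_distrib)
        also have "Q * \<dots> \<le> Q * \<delta>"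
          using Q p(3) M1 by (intro mult_left_mono) (auto simp: field_simps)
        finally have "\<bar>v p - v p'\<bar> / real M \<le> Q * \<delta>" using M1 by (simp flip: diff_divide_distrib)
        then show ?thesis using M1 by (simp add: field_simps)
      qed
      \<comment> \<open>First coordinates range over M / 2 to 3 M, that is M' to 6 M', which is why
        the count was taken with \<omega> = 6.\<close>
      define M' where "M' = real M / 2"
      have M': "M' \<ge> 1" using big by (simp add: M'_def)
      define W where "W = (\<lambda>((a, b), (c, d)). (a, b, c, d)) ` {(p, p') \<in> A \<times> A. \<bar>v p - v p'\<bar> \<le> \<eta> / M'}"
      have injW: "inj_on (\<lambda>((a::int, b::int), (c::int, d::int)). (a, b, c, d)) S" for S by (auto simp: inj_on_def)
      have finP: "finite {(p, p') \<in> A \<times> A. R p p'}" for R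
        by (rule finite_subset[of _ "A \<times> A"]) (use finA in auto)
      have finW: "finite W" unfolding W_def by (rule finite_imageI) (rule finP)
      have "real (card W) \<le> D * M' powr (2 + \<epsilon>)"
      proof (rule count'[THEN spec, THEN mp, OF M', THEN spec, THEN spec, THEN spec, THEN mp, OF finW, THEN mp])
        have sector: "in_sector (x1 p) (x2 p)" if "p \<in> A" for p
          using size[OF that] big unfolding in_sector_def by linarith
        have "near_equal (\<eta> / M') (x1 p) (x2 p) (x1 p') (x2 p') \<and> M' \<le> x1 p \<and> x1 p \<le> 6 * M'"
          if p: "p \<in> A" "p' \<in> A" "\<bar>v p - v p'\<bar> \<le> \<eta> / M'" for p p'
        proof -
          have "6 * x1 p' \<le> \<Gamma> * x1 p'" "6 * x1 p \<le> \<Gamma> * x1 p"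
            using \<Gamma>6 size[OF p(1)] size[OF p(2)] M1 by (auto intro!: mult_right_mono)
          then show ?thesis
            using sector[OF p(1)] sector[OF p(2)] size[OF p(1)] size[OF p(2)] p(3)
            unfolding near_equal_def v_def M'_def by auto
        qed
        then show "\<forall>(m1, m2, m3, m4)\<in>W. near_equal (\<eta> / M') (of_int m1 + \<theta>1) (of_int m2 + \<theta>2) (of_int m3 + \<theta>1) (of_int m4 + \<theta>2)
          \<and> M' \<le> of_int m1 + \<theta>1 \<and> of_int m1 + \<theta>1 \<le> 6 * M'"
          unfolding W_def x1_def x2_def by fastforce
      qed
      also have "card W = card {(p, p') \<in> A \<times> A. \<bar>v p - v p'\<bar> \<le> \<eta> / M'}"
        unfolding W_def by (intro card_image injW)
      finally have E: "real (card {(p, p') \<in> A \<times> A. \<bar>v p - v p'\<bar> \<le> \<eta> / M'}) \<le> D * M' powr (2 + \<epsilon>)" .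
      have "M' powr (2 + \<epsilon>) \<le> real M powr (2 + \<epsilon>)"
        using \<epsilon> M1 by (intro powr_mono2) (auto simp: M'_def)
      then have E': "real (card {(p, p') \<in> A \<times> A. \<bar>v p - v p'\<bar> \<le> \<eta> / M'}) \<le> D * real M powr (2 + \<epsilon>)"
        using E D by (meson less_imp_le mult_left_mono order_trans)
      \<comment> \<open>The original quadruple alternates between the two points: they are (m1, m3)
        and (m2, m4). In \<open>W\<close>, by contrast, the two coordinates of each point are
        adjacent.\<close>
      have "card ((\<lambda>(a, b, c, d). ((a, c), (b, d))) ` approx_solutions \<theta>1 \<theta>2 \<beta> M \<alpha> \<delta>) = approx_count \<theta>1 \<theta>2 \<beta> M \<alpha> \<delta>"
        unfolding approx_count_def by (intro card_image) (auto simp: inj_on_def)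
      moreover have "(\<lambda>(a, b, c, d). ((a, c), (b, d))) ` approx_solutions \<theta>1 \<theta>2 \<beta> M \<alpha> \<delta>
          \<subseteq> {(p, p') \<in> A \<times> A. \<bar>v p - v p'\<bar> \<le> Q * \<delta> * real M}"
      proof clarify
        fix a b c d :: int
        assume s: "(a, b, c, d) \<in> approx_solutions \<theta>1 \<theta>2 \<beta> M \<alpha> \<delta>"
        then have "(a, c) \<in> A" "(b, d) \<in> A" by (auto simp: approx_solutions_def A_def)
        moreover have "\<bar>F (a, c) - F (b, d)\<bar> \<le> \<delta> * real M powr \<alpha>"
          using s by (simp add: approx_solutions_def F_def x1_def x2_def algebra_simps)
        ultimately show "((a, c), (b, d)) \<in> A \<times> A \<and> \<bar>v (a, c) - v (b, d)\<bar> \<le> Q * \<delta> * real M"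
          using close by auto
      qed
      then have "card ((\<lambda>(a, b, c, d). ((a, c), (b, d))) ` approx_solutions \<theta>1 \<theta>2 \<beta> M \<alpha> \<delta>)
          \<le> card {(p, p') \<in> A \<times> A. \<bar>v p - v p'\<bar> \<le> Q * \<delta> * real M}"
        by (intro card_mono finP)
      ultimately have "real (approx_count \<theta>1 \<theta>2 \<beta> M \<alpha> \<delta>) \<le> real (card {(p, p') \<in> A \<times> A. \<bar>v p - v p'\<bar> \<le> Q * \<delta> * real M})"
        by simp
      \<comment> \<open>Passing from tolerance Q \<delta> M to \<eta> / M' costs a factor O(1 +
        \<delta> M^2), which produces the two terms of the final bound.\<close>
      also have "\<dots> \<le> (2 * (Q * \<delta> * real M) / (\<eta> / M') + 3) * real (card {(p, p') \<in> A \<times> A. \<bar>v p - v p'\<bar> \<le> \<eta> / M'})"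
        using finA \<eta> M' Q \<delta> by (intro card_close_pairs_le) auto
      also have "\<dots> \<le> (2 * (Q * \<delta> * real M) / (\<eta> / M') + 3) * (D * real M powr (2 + \<epsilon>))"
        using E' \<eta> M' Q \<delta> by (intro mult_left_mono) auto
      also have "2 * (Q * \<delta> * real M) / (\<eta> / M') = Q / \<eta> * (\<delta> * (real M)\<^sup>2)"
        by (simp add: M'_def power2_eq_square)
      also have "(Q / \<eta> * (\<delta> * (real M)\<^sup>2) + 3) * (D * real M powr (2 + \<epsilon>))
          \<le> ((Q / \<eta> + 3) * (1 + \<delta> * (real M)\<^sup>2)) * (D * real M powr (2 + \<epsilon>))"
      proof (intro mult_right_mono)
        have "Q / \<eta> \<ge> 0" "\<delta> * (real M)\<^sup>2 \<ge> 0" using Q \<eta> \<delta> by auto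
        then show "Q / \<eta> * (\<delta> * (real M)\<^sup>2) + 3 \<le> (Q / \<eta> + 3) * (1 + \<delta> * (real M)\<^sup>2)"
          by (simp add: algebra_simps add_nonneg_nonneg)
      qed (use D in auto)
      also have "\<dots> = ((Q / \<eta> + 3) * D) * (real M powr (2 + \<epsilon>) + \<delta> * ((real M)\<^sup>2 * real M powr (2 + \<epsilon>)))"
        by (simp add: algebra_simps)
      also have "(real M)\<^sup>2 * real M powr (2 + \<epsilon>) = real M powr (4 + \<epsilon>)"
      proof -
        have "(real M)\<^sup>2 * real M powr (2 + \<epsilon>) = real M powr 2 * real M powr (2 + \<epsilon>)" using M1 by simp
        also have "\<dots> = real M powr (2 + (2 + \<epsilon>))" by (rule powr_add[symmetric])
        finally show ?thesis by (simp add: add.assoc[symmetric])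
      qed
      also have "((Q / \<eta> + 3) * D) * (real M powr (2 + \<epsilon>) + \<delta> * real M powr (4 + \<epsilon>))
          \<le> C * (real M powr (2 + \<epsilon>) + \<delta> * real M powr (4 + \<epsilon>))"
        using \<delta> by (intro mult_right_mono) (auto simp: C_def)
      finally show ?thesis .
    qed
  qed
qed

theorem theorem3:
  fixes \<theta>1 \<theta>2 \<alpha> \<beta> :: real
  assumes "\<alpha> \<noteq> 0" and "\<alpha> \<noteq> 1" and "\<beta> \<noteq> 0"
  shows "\<forall>\<epsilon>>0. \<exists>C>0. \<forall>(M::nat) (\<delta>::real).
           M > 0 \<and> real M + \<theta>1 > 0 \<and> real M + \<theta>2 > 0 \<and> 0 < \<delta> \<and> \<delta> < 1 \<longrightarrow>
           real (approx_count \<theta>1 \<theta>2 \<beta> M \<alpha> \<delta>)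
             \<le> C * (real M powr (2 + \<epsilon>) + \<delta> * real M powr (4 + \<epsilon>))"
proof (intro allI impI)
  fix \<epsilon> :: real assume \<epsilon>: "\<epsilon> > 0"
  have eq: "approx_count \<theta>1 \<theta>2 \<bar>\<beta>\<bar> M \<alpha> \<delta> = approx_count \<theta>1 \<theta>2 \<beta> M \<alpha> \<delta>" for M \<delta>
    by (cases "\<beta> \<ge> 0") (simp_all add: approx_count_uminus)
  have "\<bar>\<beta>\<bar> > 0" using assms by simp
  from approx_count_pos_coeff[OF assms(1,2) this \<epsilon>, of \<theta>1 \<theta>2]
  show "\<exists>C>0. \<forall>(M::nat) (\<delta>::real).
           M > 0 \<and> real M + \<theta>1 > 0 \<and> real M + \<theta>2 > 0 \<and> 0 < \<delta> \<and> \<delta> < 1 \<longrightarrow>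
           real (approx_count \<theta>1 \<theta>2 \<beta> M \<alpha> \<delta>)
             \<le> C * (real M powr (2 + \<epsilon>) + \<delta> * real M powr (4 + \<epsilon>))"
    unfolding eq by blast
qed

end
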